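(* For all $n \geq 1$: (1) $\mathfrak{p}^{(n)} = \mathcal{I}_n R$; (2) $\mathfrak{p}^{(n)} = \sum_{a_1 + 2a_2 = n} \mathfrak{p}^{a_1} (\mathfrak{p}^{(2)})^{a_2}$, the sum being over all integers $a_1, a_2 \geq 0$ with $a_1 + 2a_2 = n$; (3) $I_n = \mathcal{I}_n T'$, and the image of $\mathfrak{p}^{(n)}$ in $R/x_1R = \Bbbk[[x_2,x_3]]$ equals $I_n \Bbbk[[x_2,x_3]]$.
   Context: Let $\Bbbk$ be a field and let $q, m \geq 1$ be integers with $\gcd(2q+1, m) = 1$. Put $n_i = 2q+1+(i-1)m$ for $i=1,2,3$. Let $R = \Bbbk[[x_1,x_2,x_3]]$, and let $\mathfrak{p} = \ker(\phi)$, where $\phi : R \to \Bbbk[[t]]$ is the $\Bbbk$-algebra homomorphism of power series rings with $\phi(x_i) = t^{n_i}$. For $n\ge 0$, $\mathfrak{p}^{(n)} = \mathfrak{p}^n R_{\mathfrak{p}} \cap R$ is the $n$-th symbolic power. Let $T = \Bbbk[x_1,x_2,x_3] \subset R$ and $g_1 = x_1^{m+q}x_2 - x_3^{q+1}$, $g_2 = x_1^{m+q+1} - x_2x_3^q$, $g_3 = x_2^2 - x_1x_3$, $f_2 = -x_1^{2(m+q)+1} - x_1^{m+q-1}x_2^3x_3^{q-1} + 3x_1^{m+q}x_2x_3^q - x_3^{2q+1}$. Let $\mathcal{J}_1 T = (g_1,g_2,g_3)T$, $\mathcal{J}_2T = (f_2)T$, and $\mathcal{I}_nT = \sum_{a_1+2a_2=n,\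 a_1,a_2\ge 0} (\mathcal{J}_1T)^{a_1}(\mathcal{J}_2T)^{a_2}$. Write $\mathcal{I}_nR$ for the extension of $\mathcal{I}_nT$ to $R$. Let $T' = \Bbbk[x_2,x_3] \cong T/x_1T$, and write $\mathcal{I}_nT'$ for the image of $\mathcal{I}_nT$ in $T'$. Let $J_1 = (x_2^2, x_2x_3^q, x_3^{q+1})T'$, $J_2 = (x_3^{2q+1})T'$ and $I_n = \sum_{a_1+2a_2=n,\ a_1,a_2\ge0} J_1^{a_1}J_2^{a_2}$. *)

theory Defs
  imports
    "HOL-Computational_Algebra.Computational_Algebra"
    "HOL-Algebra.Ideal_Product"
    "HOL-Algebra.RingHom"
    "HOL-Decision_Procs.Algebra_Aux"
begin

unbundle fps_syntax

text \<open>
  The record \<^const>\<open>cring_class_ops\<close> views a type of class \<open>comm_ring_1\<close> as a ring in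
  the sense of HOL-Algebra, and \<^const>\<open>ideals_set\<close> is the semiring of its ideals: its product is
  the product of ideals, its sum is the sum of ideals and its unit is the whole ring.
\<close>

abbreviation idl :: "'a::comm_ring_1 set \<Rightarrow> 'a set"
  where "idl S \<equiv> Idl\<^bsub>cring_class_ops\<^esub> S"

abbreviation ideal_pow :: "'a::comm_ring_1 set \<Rightarrow> nat \<Rightarrow> 'a set"
  where "ideal_pow I n \<equiv> I [^]\<^bsub>ideals_set cring_class_ops\<^esub> n"

text \<open>\<open>weighted_sum A B n\<close> is the sum of the ideals \<open>A^a1 B^a2\<close> over all \<open>a1 + 2 a2 = n\<close>.\<close>

definition weighted_sum :: "'a::comm_ring_1 set \<Rightarrow> 'a set \<Rightarrow> nat \<Rightarrow> 'a set" where
  "weighted_sum A B n =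
     (\<Oplus>\<^bsub>ideals_set cring_class_ops\<^esub> a \<in> {(a1, a2). a1 + 2 * a2 = n}.
        ideal_pow A (fst a) \<otimes>\<^bsub>ideals_set cring_class_ops\<^esub> ideal_pow B (snd a))"


section \<open>Symbolic powers in a domain\<close>

text \<open>
  For a prime ideal \<open>P\<close> of a domain, the localization at \<open>P\<close> is realized as a subring of the
  field of fractions.
\<close>

definition localization :: "'a::idom set \<Rightarrow> 'a fract ring" where
  "localization P =
     \<lparr>carrier = {Fraction_Field.Fract a s | a s. s \<notin> P},
      mult = (*), one = 1, zero = 0, add = (+)\<rparr>"

definition symbolic_power :: "'a::idom set \<Rightarrow> nat \<Rightarrow> 'a set" where
  "symbolic_power P n =
     {r. Fraction_Field.Fract r 1 \<in>
           Idl\<^bsub>localization P\<^esub> ((\<lambda>a. Fraction_Field.Fract a 1) ` ideal_pow P n)}"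


section \<open>The power series ring and the monomial curve\<close>

text \<open>
  \<open>k[[x1,x2,x3]]\<close> is the type \<open>'k fps fps fps\<close> and \<open>k[x1,x2,x3]\<close> is the type
  \<open>'k poly poly poly\<close>, where \<open>x1\<close> is the outermost and \<open>x3\<close> the innermost variable: the
  coefficient of \<open>x1^i x2^j x3^k\<close> in \<open>F\<close> is \<open>F $ i $ j $ k\<close>. Likewise \<open>k[[x2,x3]]\<close> is
  \<open>'k fps fps\<close> and \<open>k[x2,x3]\<close> is \<open>'k poly poly\<close>, with \<open>x2\<close> outermost.
\<close>

definition weight :: "nat \<Rightarrow> nat \<Rightarrow> nat \<Rightarrow> nat" where
  "weight q m i = 2 * q + 1 + (i - 1) * m"

text \<open>The substitution homomorphism with \<open>x_i \<mapsto> t^(n_i)\<close>; the sum is finite as all \<open>n_i\<close> are positive.\<close>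

definition phi :: "nat \<Rightarrow> nat \<Rightarrow> 'k::field fps fps fps \<Rightarrow> 'k fps" where
  "phi q m F = Abs_fps (\<lambda>d.
     \<Sum>(i, j, k) \<in> {(i, j, k). weight q m 1 * i + weight q m 2 * j + weight q m 3 * k = d}.
       F $ i $ j $ k)"

definition curve_prime :: "nat \<Rightarrow> nat \<Rightarrow> 'k::field fps fps fps set" where
  "curve_prime q m = a_kernel cring_class_ops cring_class_ops (phi q m)"


section \<open>The ideals in the polynomial rings\<close>

definition x1 :: "'k::field poly poly poly" where "x1 = [:0, 1:]"
definition x2 :: "'k::field poly poly poly" where "x2 = [:[:0, 1:]:]"
definition x3 :: "'k::field poly poly poly" where "x3 = [:[:[:0, 1:]:]:]"

definition g1 :: "nat \<Rightarrow> nat \<Rightarrow> 'k::field poly poly poly" where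
  "g1 q m = x1 ^ (m + q) * x2 - x3 ^ (q + 1)"

definition g2 :: "nat \<Rightarrow> nat \<Rightarrow> 'k::field poly poly poly" where
  "g2 q m = x1 ^ (m + q + 1) - x2 * x3 ^ q"

definition g3 :: "'k::field poly poly poly" where
  "g3 = x2 ^ 2 - x1 * x3"

text \<open>The subtractions in the exponents do not truncate, as \<open>q \<ge> 1\<close> in all uses.\<close>

definition f2 :: "nat \<Rightarrow> nat \<Rightarrow> 'k::field poly poly poly" where
  "f2 q m = - (x1 ^ (2 * (m + q) + 1)) - x1 ^ (m + q - 1) * x2 ^ 3 * x3 ^ (q - 1)
            + 3 * x1 ^ (m + q) * x2 * x3 ^ q - x3 ^ (2 * q + 1)"

definition cal_I :: "nat \<Rightarrow> nat \<Rightarrow> nat \<Rightarrow> 'k::field poly poly poly set" where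
  "cal_I q m n = weighted_sum (idl {g1 q m, g2 q m, g3}) (idl {f2 q m}) n"

text \<open>\<open>y2\<close> and \<open>y3\<close> are \<open>x2\<close> and \<open>x3\<close> as elements of \<open>k[x2,x3]\<close>.\<close>

definition y2 :: "'k::field poly poly" where "y2 = [:0, 1:]"
definition y3 :: "'k::field poly poly" where "y3 = [:[:0, 1:]:]"

definition initial_I :: "nat \<Rightarrow> nat \<Rightarrow> 'k::field poly poly set" where
  "initial_I q n = weighted_sum (idl {y2 ^ 2, y2 * y3 ^ q, y3 ^ (q + 1)}) (idl {y3 ^ (2 * q + 1)}) n"


section \<open>Inclusions of polynomials into power series, and reduction modulo \<open>x1\<close>\<close>

definition emb2 :: "'k::field poly poly \<Rightarrow> 'k fps fps" where
  "emb2 p = Abs_fps (\<lambda>j. fps_of_poly (coeff p j))"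

definition emb3 :: "'k::field poly poly poly \<Rightarrow> 'k fps fps fps" where
  "emb3 p = Abs_fps (\<lambda>i. emb2 (coeff p i))"

text \<open>
  As \<open>x1\<close> is the outermost variable, the projections modulo \<open>x1\<close> with values in \<open>k[x2,x3]\<close> and
  \<open>k[[x2,x3]]\<close> take the coefficient of \<open>x1^0\<close>.
\<close>

definition poly_mod_x1 :: "'k::field poly poly poly \<Rightarrow> 'k poly poly" where
  "poly_mod_x1 p = coeff p 0"

definition fps_mod_x1 :: "'k::field fps fps fps \<Rightarrow> 'k fps fps" where
  "fps_mod_x1 F = F $ 0"


section \<open>Sanity checks\<close>

lemma emb3_variables:
  "emb3 (x1 :: 'k::field poly poly poly) = fps_X"
  "emb3 (x2 :: 'k poly poly poly) = fps_const fps_X"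
  "emb3 (x3 :: 'k poly poly poly) = fps_const (fps_const fps_X)"
proof -
  have *: "emb2 0 = (0 :: 'k fps fps)" "emb2 1 = (1 :: 'k fps fps)"
    by (rule fps_ext; simp add: emb2_def)+
  have const2: "emb2 [:p:] = fps_const (fps_of_poly p)" for p :: "'k poly"
    by (rule fps_ext) (simp add: emb2_def coeff_pCons split: nat.split)
  have const3: "emb3 [:p:] = fps_const (emb2 p)" for p :: "'k poly poly"
    by (rule fps_ext) (simp add: emb3_def coeff_pCons * split: nat.split)
  have "emb2 [:0, 1:] = (fps_X :: 'k fps fps)"
    by (rule fps_ext) (simp add: emb2_def coeff_pCons split: nat.split)
  then show "emb3 (x2 :: 'k poly poly poly) = fps_const fps_X"
    by (simp add: x2_def const3)
  show "emb3 (x3 :: 'k poly poly poly) = fps_const (fps_const fps_X)"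
    by (simp add: x3_def const3 const2)
  show "emb3 (x1 :: 'k poly poly poly) = fps_X"
    by (rule fps_ext) (simp add: emb3_def x1_def coeff_pCons * split: nat.split)
qed

lemma poly_mod_x1_kernel: "poly_mod_x1 p = 0 \<longleftrightarrow> x1 dvd p"
  by (simp add: poly_mod_x1_def x1_def poly_0_coeff_0[symmetric] poly_eq_0_iff_dvd)

lemma poly_mod_x1_surj: "surj (poly_mod_x1 :: 'k::field poly poly poly \<Rightarrow> _)"
proof (rule surjI)
  show "poly_mod_x1 [:p:] = p" for p :: "'k poly poly"
    by (simp add: poly_mod_x1_def)
qed

lemma fps_mod_x1_kernel: "fps_mod_x1 F = 0 \<longleftrightarrow> emb3 x1 dvd F"
proof
  assume *: "fps_mod_x1 F = 0"
  have "F = fps_X * fps_shift 1 F"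
    by (rule fps_ext) (use * in \<open>simp add: fps_mod_x1_def\<close>)
  then show "emb3 x1 dvd F"
    unfolding emb3_variables by (rule dvdI)
qed (auto simp: fps_mod_x1_def emb3_variables)

lemma fps_mod_x1_surj: "surj (fps_mod_x1 :: 'k::field fps fps fps \<Rightarrow> _)"
proof (rule surjI)
  show "fps_mod_x1 (fps_const F) = F" for F :: "'k fps fps"
    by (simp add: fps_mod_x1_def)
qed

abbreviation wt :: "nat \<Rightarrow> nat \<Rightarrow> nat \<times> nat \<times> nat \<Rightarrow> nat" where
  "wt q m u \<equiv> weight q m 1 * fst u + weight q m 2 * fst (snd u) + weight q m 3 * snd (snd u)"

abbreviation cf :: "'k::field fps fps fps \<Rightarrow> nat \<times> nat \<times> nat \<Rightarrow> 'k" where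
  "cf F u \<equiv> F $ fst u $ fst (snd u) $ snd (snd u)"

lemma finite_wt: "finite {u. wt q m u \<le> d}"
proof (rule finite_subset)
  show "{u. wt q m u \<le> d} \<subseteq> {..d} \<times> {..d} \<times> {..d}"
  proof
    fix u assume "u \<in> {u. wt q m u \<le> d}"
    moreover obtain i j k where u: "u = (i, j, k)" by (cases u)
    ultimately have "weight q m 1 * i + weight q m 2 * j + weight q m 3 * k \<le> d"
      by (simp only: mem_Collect_eq fst_conv snd_conv)
    moreover have "i \<le> weight q m 1 * i" "j \<le> weight q m 2 * j" "k \<le> weight q m 3 * k"
      by (auto simp: weight_def)
    ultimately have "i \<le> d" "j \<le> d" "k \<le> d" by linarith+
    then show "u \<in> {..d} \<times> {..d} \<times> {..d}" using u by simp
  qed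
qed simp

lemma phi_nth: "phi q m F $ d = (\<Sum>u | wt q m u = d. cf F u)"
  unfolding phi_def by (auto intro!: sum.cong simp: case_prod_beta)

lemma cf_mult:
  "cf (F * G) (i, j, k) = (\<Sum>(a, b, c) \<in> {..i} \<times> {..j} \<times> {..k}. cf F (a, b, c) * cf G (i - a, j - b, k - c))"
proof -
  have "(F * G) $ i $ j $ k =
      (\<Sum>a\<le>i. \<Sum>b\<le>j. \<Sum>c\<le>k. F $ a $ b $ c * G $ (i - a) $ (j - b) $ (k - c))"
    by (simp only: fps_mult_nth fps_sum_nth atLeast0AtMost)
  then show ?thesis
    by (simp add: sum.cartesian_product case_prod_beta)
qed

lemma wt_diff:
  fixes a1 a2 a3 :: nat
  assumes "b1 \<le> a1" "b2 \<le> a2" "b3 \<le> a3"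
  shows "w1 * b1 + w2 * b2 + w3 * b3 + (w1 * (a1 - b1) + w2 * (a2 - b2) + w3 * (a3 - b3))
           = w1 * a1 + w2 * a2 + w3 * a3"
proof -
  have "w1 * b1 + w1 * (a1 - b1) = w1 * a1" "w2 * b2 + w2 * (a2 - b2) = w2 * a2"
    "w3 * b3 + w3 * (a3 - b3) = w3 * a3"
    using assms by (simp_all flip: distrib_left)
  then show ?thesis by linarith
qed

lemma phi_mult: "phi q m (F * G) = phi q m F * phi q m G"
proof (rule fps_ext)
  fix d
  let ?T = "{(u, v). wt q m u + wt q m v = d}"
  let ?h = "\<lambda>p. cf F (fst p) * cf G (snd p)"
  let ?A = "\<lambda>u. {..fst u} \<times> {..fst (snd u)} \<times> {..snd (snd u)}"
  define merge :: "(nat \<times> nat \<times> nat) \<times> (nat \<times> nat \<times> nat) \<Rightarrow> (nat \<times> nat \<times> nat) \<times> (nat \<times> nat \<times> nat)"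
    where "merge = (\<lambda>(u, v). ((fst u + fst v, fst (snd u) + fst (snd v), snd (snd u) + snd (snd v)), u))"
  define parts :: "(nat \<times> nat \<times> nat) \<times> (nat \<times> nat \<times> nat) \<Rightarrow> (nat \<times> nat \<times> nat) \<times> (nat \<times> nat \<times> nat)"
    where "parts = (\<lambda>(u, v). (v, (fst u - fst v, fst (snd u) - fst (snd v), snd (snd u) - snd (snd v))))"
  have fin: "finite {u. wt q m u = e}" for e
    by (rule finite_subset[OF _ finite_wt[of q m e]]) auto
  have "phi q m (F * G) $ d =
      (\<Sum>u | wt q m u = d. \<Sum>v \<in> ?A u.
         cf F v * cf G (fst u - fst v, fst (snd u) - fst (snd v), snd (snd u) - snd (snd v)))"
    unfolding phi_nth
  proof (rule sum.cong[OF refl], goal_cases)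
    case (1 u)
    then show ?case using cf_mult[of F G "fst u" "fst (snd u)" "snd (snd u)"]
      by (simp add: case_prod_beta)
  qed
  also have "\<dots> = (\<Sum>(u, v) \<in> (SIGMA u:{u. wt q m u = d}. ?A u).
         cf F v * cf G (fst u - fst v, fst (snd u) - fst (snd v), snd (snd u) - snd (snd v)))"
    by (rule sum.Sigma) (use fin in auto)
  also have "\<dots> = sum ?h ?T"
  proof (rule sum.reindex_bij_witness[where i = merge and j = parts])
    fix p assume "p \<in> (SIGMA u:{u. wt q m u = d}. ?A u)"
    then obtain i j k a b c where p: "p = ((i, j, k), (a, b, c))"
      and wt: "weight q m 1 * i + weight q m 2 * j + weight q m 3 * k = d"
      and le: "a \<le> i" "b \<le> j" "c \<le> k"
      by auto
    show "merge (parts p) = p"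
      using le by (simp add: p merge_def parts_def)
    show "parts p \<in> ?T"
      using wt_diff[OF le, of "weight q m 1" "weight q m 2" "weight q m 3"] wt
      by (simp only: p parts_def prod.case fst_conv snd_conv mem_Collect_eq)
    show "?h (parts p) = (case p of (u, v) \<Rightarrow> cf F v *
        cf G (fst u - fst v, fst (snd u) - fst (snd v), snd (snd u) - snd (snd v)))"
      by (simp only: p parts_def prod.case fst_conv snd_conv)
  next
    fix p assume "p \<in> ?T"
    then obtain i j k a b c where p: "p = ((i, j, k), (a, b, c))"
      and wt: "wt q m (i, j, k) + wt q m (a, b, c) = d"
      by (cases p) auto
    show "parts (merge p) = p"
      by (simp add: p merge_def parts_def)
    have "wt q m (i + a, j + b, k + c) = d"
      using wt by (simp only: fst_conv snd_conv distrib_left)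
    then show "merge p \<in> (SIGMA u:{u. wt q m u = d}. ?A u)"
      by (simp add: p merge_def)
  qed
  finally have 1: "phi q m (F * G) $ d = sum ?h ?T" .
  have "(phi q m F * phi q m G) $ d =
      (\<Sum>e\<le>d. \<Sum>p \<in> {u. wt q m u = e} \<times> {u. wt q m u = d - e}. ?h p)"
    by (simp add: fps_mult_nth phi_nth sum_product sum.cartesian_product case_prod_beta atLeast0AtMost)
  also have "\<dots> = sum ?h (\<Union>e\<in>{..d}. {u. wt q m u = e} \<times> {u. wt q m u = d - e})"
    by (subst sum.UNION_disjoint) (use fin in auto)
  also have "(\<Union>e\<in>{..d}. {u. wt q m u = e} \<times> {u. wt q m u = d - e}) = ?T"
    by auto
  finally show "phi q m (F * G) $ d = (phi q m F * phi q m G) $ d" using 1 by simp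
qed

lemma phi_add: "phi q m (F + G) = phi q m F + phi q m G"
  by (rule fps_ext) (simp add: phi_nth sum.distrib)

lemma phi_monomial:
  fixes c :: "'k::field"
  shows "phi q m (Abs_fps (\<lambda>i. Abs_fps (\<lambda>j. Abs_fps (\<lambda>k. if (i, j, k) = u then c else 0))))
           = fps_const c * fps_X ^ wt q m u"
proof (rule fps_ext)
  fix d
  have fin: "finite {v. wt q m v = d}"
    by (rule finite_subset[OF _ finite_wt[of q m d]]) auto
  have "phi q m (Abs_fps (\<lambda>i. Abs_fps (\<lambda>j. Abs_fps (\<lambda>k. if (i, j, k) = u then c else 0)))) $ d
      = (\<Sum>v | wt q m v = d. if v = u then c else 0)"
    unfolding phi_nth by (intro sum.cong) auto
  also have "\<dots> = (if wt q m u = d then c else 0)"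
    using fin by (simp add: sum.delta)
  also have "\<dots> = (fps_const c * fps_X ^ wt q m u) $ d" by simp
  finally show "phi q m (Abs_fps (\<lambda>i. Abs_fps (\<lambda>j. Abs_fps (\<lambda>k. if (i, j, k) = u then c else 0)))) $ d
      = (fps_const c * fps_X ^ wt q m u) $ d" .
qed

lemma phi_const: "phi q m (fps_const (fps_const (fps_const c))) = fps_const c"
proof -
  have "fps_const (fps_const (fps_const c)) =
      Abs_fps (\<lambda>i. Abs_fps (\<lambda>j. Abs_fps (\<lambda>k. if (i, j, k) = (0, 0, 0) then c else 0)))"
    by (intro fps_ext) simp
  then show ?thesis using phi_monomial[of q m "(0, 0, 0)" c] by simp
qed

lemma phi_variables:
  "phi q m (emb3 (x1 :: 'k::field poly poly poly)) = fps_X ^ weight q m 1"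
  "phi q m (emb3 (x2 :: 'k poly poly poly)) = fps_X ^ weight q m 2"
  "phi q m (emb3 (x3 :: 'k poly poly poly)) = fps_X ^ weight q m 3"
proof -
  have "emb3 x1 = Abs_fps (\<lambda>i. Abs_fps (\<lambda>j. Abs_fps (\<lambda>k. if (i, j, k) = (1, 0, 0) then 1 :: 'k else 0)))"
    "emb3 x2 = Abs_fps (\<lambda>i. Abs_fps (\<lambda>j. Abs_fps (\<lambda>k. if (i, j, k) = (0, 1, 0) then 1 :: 'k else 0)))"
    "emb3 x3 = Abs_fps (\<lambda>i. Abs_fps (\<lambda>j. Abs_fps (\<lambda>k. if (i, j, k) = (0, 0, 1) then 1 :: 'k else 0)))"
    unfolding emb3_variables by (intro fps_ext; simp)+
  then show "phi q m (emb3 (x1 :: 'k poly poly poly)) = fps_X ^ weight q m 1"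
    "phi q m (emb3 (x2 :: 'k poly poly poly)) = fps_X ^ weight q m 2"
    "phi q m (emb3 (x3 :: 'k poly poly poly)) = fps_X ^ weight q m 3"
    using phi_monomial[of q m "(1, 0, 0)" "1 :: 'k"] phi_monomial[of q m "(0, 1, 0)" "1 :: 'k"]
      phi_monomial[of q m "(0, 0, 1)" "1 :: 'k"] by simp_all
qed

lemma phi_ring_hom:
  "ring_hom_cring cring_class_ops cring_class_ops (phi q m :: 'k::field fps fps fps \<Rightarrow> _)"
proof -
  have "phi q m (1 :: 'k fps fps fps) = 1"
    using phi_const[of q m "1 :: 'k"] by simp
  then show ?thesis
    by (intro ring_hom_cringI ring_hom_ringI2 ring_hom_memI cring_class cring.axioms(1)[OF cring_class])
      (auto simp: class_simps phi_mult phi_add)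
qed

lemma curve_prime_eq: "curve_prime q m = {F. phi q m F = 0}"
  by (auto simp: curve_prime_def a_kernel_def' class_simps)

lemma curve_prime_primeideal: "primeideal (curve_prime q m :: 'k::field fps fps fps set) cring_class_ops"
proof -
  interpret ring_hom_cring cring_class_ops cring_class_ops "phi q m :: 'k fps fps fps \<Rightarrow> _"
    by (rule phi_ring_hom)
  have one: "phi q m (1 :: 'k fps fps fps) = 1"
    using phi_const[of q m "1 :: 'k"] by simp
  show ?thesis
  proof (rule primeidealI)
    show "ideal (curve_prime q m :: 'k fps fps fps set) cring_class_ops"
      unfolding curve_prime_def by (rule ring.kernel_is_ideal)
    show "cring (cring_class_ops :: 'k fps fps fps ring)" by (rule cring_class)
    show "carrier cring_class_ops \<noteq> (curve_prime q m :: 'k fps fps fps set)"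
      using one carrier_class[of "1 :: 'k fps fps fps"] curve_prime_eq[of q m] by force
    show "a \<in> curve_prime q m \<or> b \<in> curve_prime q m"
      if "a \<otimes>\<^bsub>cring_class_ops\<^esub> b \<in> curve_prime q m" for a b :: "'k fps fps fps"
      using that by (auto simp: curve_prime_eq class_simps phi_mult)
  qed
qed

lemma localization_cring:
  fixes P :: "'a::idom set"
  assumes "primeideal P cring_class_ops"
  shows "cring (localization P)"
proof -
  interpret P: primeideal P cring_class_ops by fact
  have zero: "0 \<in> P"
    using P.zero_closed by (simp add: class_simps)
  have nz: "s \<noteq> 0" if "s \<notin> P" for s
    using zero that by auto
  have mult: "s * t \<notin> P" if "s \<notin> P" "t \<notin> P" for s t
    using P.I_prime[of s t] that by (auto simp: class_simps)
  have one: "1 \<notin> P"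
    using P.one_imp_carrier P.I_notcarr by (auto simp: class_simps)
  define L where "L = {Fraction_Field.Fract a s | a s. s \<notin> P}"
  have cl: "x + y \<in> L" "x * y \<in> L" "- x \<in> L" if xy: "x \<in> L" "y \<in> L" for x y
  proof -
    obtain a s b t where "x = Fraction_Field.Fract a s" "s \<notin> P"
      "y = Fraction_Field.Fract b t" "t \<notin> P" using xy unfolding L_def by blast
    moreover from this have "s * t \<notin> P" "s \<noteq> 0" "t \<noteq> 0" using mult nz by auto
    ultimately show "x + y \<in> L" "x * y \<in> L" "- x \<in> L"
      unfolding L_def by auto
  qed
  have "0 \<in> L" "1 \<in> L"
    using one by (auto simp: L_def Zero_fract_def One_fract_def)
  moreover have "\<exists>y\<in>L. y + x = 0" if "x \<in> L" for x
    using cl(3)[OF that that] by (intro bexI[of _ "- x"]) auto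
  moreover have "localization P = \<lparr>carrier = L, mult = (*), one = 1, zero = 0, add = (+)\<rparr>"
    by (simp add: localization_def L_def)
  moreover have "cring \<lparr>carrier = L, mult = (*), one = 1, zero = 0, add = (+)\<rparr>"
    by (intro cringI abelian_groupI comm_monoidI)
      (use calculation cl in \<open>simp_all add: distrib_right\<close>)
  ultimately show ?thesis by simp
qed

lemma symbolic_power_ideal:
  fixes P :: "'a::idom set"
  assumes P: "primeideal P cring_class_ops"
  shows "ideal (symbolic_power P n) cring_class_ops"
proof -
  interpret P: primeideal P cring_class_ops by fact
  interpret L: cring "localization P" by (rule localization_cring[OF P])
  have one: "1 \<notin> P"
    using P.one_imp_carrier P.I_notcarr by (auto simp: class_simps)
  let ?f = "\<lambda>a :: 'a. Fraction_Field.Fract a 1"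
  have carr: "?f a \<in> carrier (localization P)" for a
    using one by (auto simp: localization_def)
  interpret I: ideal "Idl\<^bsub>localization P\<^esub> (?f ` ideal_pow P n)" "localization P"
    by (rule L.genideal_ideal) (use carr in auto)
  have zero: "0 \<in> symbolic_power P n"
    using I.zero_closed by (simp add: symbolic_power_def localization_def Zero_fract_def)
  have add: "a + b \<in> symbolic_power P n" if "a \<in> symbolic_power P n" "b \<in> symbolic_power P n" for a b
    using I.a_closed[of "?f a" "?f b"] that by (simp add: symbolic_power_def localization_def)
  have mult: "r * a \<in> symbolic_power P n" if "a \<in> symbolic_power P n" for a r
    using I.I_l_closed[of "?f a" "?f r"] that carr by (simp add: symbolic_power_def localization_def)
  have "- a \<in> symbolic_power P n" if "a \<in> symbolic_power P n" for a
    using mult[OF that, of "- 1"] by simp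
  moreover have "inv\<^bsub>add_monoid cring_class_ops\<^esub> a = - a" for a :: 'a
    using uminus_class[of a] by (simp add: a_inv_def)
  ultimately have "subgroup (symbolic_power P n) (add_monoid cring_class_ops)"
    using zero add by (intro subgroup.intro) (auto simp: class_simps)
  then show ?thesis
    using mult by (intro idealI cring.axioms(1)[OF cring_class]) (auto simp: class_simps mult.commute)
qed

end

(*
Write \<open>P\<close> for the curve prime and work modulo \<open>x1\<close>. Index the monomials of \<open>k[[x2,x3]]\<close> by triples
\<open>(a, b, r)\<close>, \<open>r < 2 q + 1\<close>: the triple stands for \<open>x2^(2 a + s mod 2) x3^(s div 2)\<close> with
\<open>s = b (2 q + 1) + r\<close>, and this monomial lies in \<open>I_n\<close> iff \<open>a + b \<ge> n\<close>. It lifts to an element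
\<open>e(a, b, r)\<close> of \<open>cal_I (a + b)\<close>, a product of \<open>g3^a\<close>, a power of \<open>f2\<close>, at most one of \<open>g1, g2\<close>,
and a monomial. By \<open>x1\<close>-adic division every power series is an element of \<open>cal_I n\<close> plus a
combination of the finitely many \<open>e(a, b, r)\<close> with \<open>a + b < n\<close>, with coefficients in \<open>k[[x1]]\<close>.

These \<open>e(a, b, r)\<close> are independent over \<open>k[[x1]]\<close> modulo the symbolic power \<open>P^(n)\<close>, so \<open>P^(n)\<close>
is contained in \<open>cal_I n\<close>. Indeed \<open>g3, g1\<close> is a regular sequence which generates \<open>P\<close> up to a factor
\<open>x2\<close> outside \<open>P\<close>, hence the associated graded ring of the symbolic filtration is a polynomial ring
after localization; there, modulo \<open>g3^(a + 1)\<close> and up to a factor \<open>x2^b\<close>, the initial form of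
\<open>e(a, b, r)\<close> is \<open>g3^a g1^b\<close> times a monomial whose weight is congruent to \<open>r m\<close> modulo
\<open>2 q + 1\<close>, and these residues are distinct as \<open>m\<close> is coprime to \<open>2 q + 1\<close>.
*)
theory Submission
  imports Defs "HOL-Number_Theory.Cong"
begin

section \<open>Ideals of a commutative ring type\<close>

abbreviation is_ideal :: "'a::comm_ring_1 set \<Rightarrow> bool"
  where "is_ideal I \<equiv> ideal I cring_class_ops"

lemma ring_class_ops: "ring (cring_class_ops :: 'a::comm_ring_1 ring)"
  by (rule cring.axioms(1)[OF cring_class])

text \<open>Negation is multiplication by \<open>- 1\<close>, so the subgroup condition reduces to
  the first two closure properties together with absorption. Ideals can then be handled with the
  class operations.\<close>

lemma is_ideal_iff:
  "is_ideal I \<longleftrightarrow> 0 \<in> I \<and> (\<forall>a\<in>I. \<forall>b\<in>I. a + b \<in> I) \<and> (\<forall>a\<in>I. \<forall>r. r * a \<in> I)"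
proof
  assume "is_ideal I"
  then interpret ideal I cring_class_ops .
  show "0 \<in> I \<and> (\<forall>a\<in>I. \<forall>b\<in>I. a + b \<in> I) \<and> (\<forall>a\<in>I. \<forall>r. r * a \<in> I)"
    using zero_closed a_closed I_l_closed by (auto simp: class_simps)
next
  assume *: "0 \<in> I \<and> (\<forall>a\<in>I. \<forall>b\<in>I. a + b \<in> I) \<and> (\<forall>a\<in>I. \<forall>r. r * a \<in> I)"
  have "- a \<in> I" if "a \<in> I" for a
    using * that by (metis mult_minus1)
  moreover have "inv\<^bsub>add_monoid cring_class_ops\<^esub> a = - a" for a :: 'a
    using uminus_class[of a] by (simp add: a_inv_def)
  ultimately have "subgroup I (add_monoid cring_class_ops)"
    using * by (intro subgroup.intro) (auto simp: class_simps)
  then show "is_ideal I"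
    using * by (intro idealI cring.axioms(1)[OF cring_class]) (auto simp: class_simps mult.commute)
qed

lemma is_idealD:
  assumes "is_ideal I"
  shows "0 \<in> I" "a \<in> I \<Longrightarrow> b \<in> I \<Longrightarrow> a + b \<in> I" "a \<in> I \<Longrightarrow> r * a \<in> I" "a \<in> I \<Longrightarrow> a * r \<in> I"
    "a \<in> I \<Longrightarrow> - a \<in> I" "a \<in> I \<Longrightarrow> b \<in> I \<Longrightarrow> a - b \<in> I"
proof -
  have *: "0 \<in> I" "\<And>a b. a \<in> I \<Longrightarrow> b \<in> I \<Longrightarrow> a + b \<in> I" "\<And>a r. a \<in> I \<Longrightarrow> r * a \<in> I"
    using assms by (auto simp: is_ideal_iff)
  have neg: "- a \<in> I" if "a \<in> I" for a
    using *(3)[OF that, of "- 1"] by simp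
  show "0 \<in> I" "a \<in> I \<Longrightarrow> b \<in> I \<Longrightarrow> a + b \<in> I" "a \<in> I \<Longrightarrow> r * a \<in> I" "a \<in> I \<Longrightarrow> a * r \<in> I"
    "a \<in> I \<Longrightarrow> - a \<in> I" "a \<in> I \<Longrightarrow> b \<in> I \<Longrightarrow> a - b \<in> I"
    using * neg *(2)[of a "- b"] by (auto simp: mult.commute)
qed

lemma is_ideal_sum: "is_ideal I \<Longrightarrow> (\<And>j. j \<in> J \<Longrightarrow> f j \<in> I) \<Longrightarrow> sum f J \<in> I"
  by (induction J rule: infinite_finite_induct) (auto simp: is_idealD)

lemma is_ideal_UNIV: "is_ideal UNIV"
  by (simp add: is_ideal_iff)

lemma is_ideal_idl: "is_ideal (idl S)"
  by (rule ring.genideal_ideal[OF ring_class_ops]) (auto simp: class_simps)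

lemma idl_incl: "x \<in> S \<Longrightarrow> x \<in> idl S"
  using ring.genideal_self[OF ring_class_ops, of S] carrier_class by blast

lemma idl_least: "is_ideal I \<Longrightarrow> S \<subseteq> I \<Longrightarrow> idl S \<subseteq> I"
  by (rule ring.genideal_minimal[OF ring_class_ops])

lemma idl_pairD:
  assumes "x \<in> idl {a, b}"
  obtains c d where "x = a * c + b * d"
proof -
  have "is_ideal {a * c + b * d | c d. True}"
    unfolding is_ideal_iff
  proof (intro conjI ballI allI)
    show "0 \<in> {a * c + b * d | c d. True}"
      by (rule CollectI, rule exI[of _ 0], rule exI[of _ 0]) simp
    show "x + y \<in> {a * c + b * d | c d. True}"
      if "x \<in> {a * c + b * d | c d. True}" "y \<in> {a * c + b * d | c d. True}" for x y
    proof -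
      from that obtain c d c' d' where "x = a * c + b * d" "y = a * c' + b * d'" by blast
      then have "x + y = a * (c + c') + b * (d + d')" by (simp add: algebra_simps)
      then show ?thesis by blast
    qed
    show "r * x \<in> {a * c + b * d | c d. True}" if "x \<in> {a * c + b * d | c d. True}" for x r
    proof -
      from that obtain c d where "x = a * c + b * d" by blast
      then have "r * x = a * (r * c) + b * (r * d)" by (simp add: algebra_simps)
      then show ?thesis by blast
    qed
  qed
  moreover have "{a, b} \<subseteq> {a * c + b * d | c d. True}"
  proof -
    have "a = a * 1 + b * 0" "b = a * 0 + b * 1" by simp_all
    then show ?thesis by blast
  qed
  ultimately have "idl {a, b} \<subseteq> {a * c + b * d | c d. True}" by (rule idl_least)
  with assms that show ?thesis by blast
qed

section \<open>Products and powers of ideals\<close>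

lemma is_ideal_prod: "is_ideal A \<Longrightarrow> is_ideal B \<Longrightarrow> is_ideal (A \<cdot>\<^bsub>cring_class_ops\<^esub> B)"
  by (rule ring.ideal_prod_is_ideal[OF ring_class_ops])

lemma ideal_prod_incl: "x \<in> A \<Longrightarrow> y \<in> B \<Longrightarrow> x * y \<in> A \<cdot>\<^bsub>cring_class_ops\<^esub> B"
  using ideal_prod.prod[of x A y B cring_class_ops] by (simp add: class_simps)

lemma ideal_prod_least:
  assumes "is_ideal I" "\<And>x y. x \<in> A \<Longrightarrow> y \<in> B \<Longrightarrow> x * y \<in> I"
  shows "A \<cdot>\<^bsub>cring_class_ops\<^esub> B \<subseteq> I"
proof
  fix z assume "z \<in> A \<cdot>\<^bsub>cring_class_ops\<^esub> B"
  then show "z \<in> I"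
    by (induction rule: ideal_prod.induct) (auto simp: class_simps assms is_idealD)
qed

lemma ideals_set_mult: "A \<otimes>\<^bsub>ideals_set R\<^esub> B = A \<cdot>\<^bsub>R\<^esub> B"
  by (simp add: ideals_set_def)

lemma ideal_pow_0: "ideal_pow A 0 = UNIV"
  by (auto simp: ideals_set_def nat_pow_def class_simps)

lemma ideal_pow_Suc: "ideal_pow A (Suc n) = ideal_pow A n \<cdot>\<^bsub>cring_class_ops\<^esub> A"
  by (simp add: ideals_set_def nat_pow_def)

text \<open>Otherwise simp unfolds powers of ideals to the record operations of
  \<open>ideals_set\<close>, and \<open>ideal_pow_0\<close> and \<open>ideal_pow_Suc\<close> no
  longer match.\<close>

declare nat_pow_0 [simp del] nat_pow_Suc [simp del]

lemma is_ideal_pow: "is_ideal A \<Longrightarrow> is_ideal (ideal_pow A n)"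
  by (induction n) (auto simp: ideal_pow_0 ideal_pow_Suc is_ideal_UNIV is_ideal_prod)

lemma ideal_pow_1: "is_ideal A \<Longrightarrow> ideal_pow A (Suc 0) = A"
  using ideal_prod_least[of A UNIV A] ideal_prod_incl[of 1 UNIV _ A]
  by (auto simp: ideal_pow_Suc ideal_pow_0 is_idealD)

lemma ideal_pow_SucI: "x \<in> ideal_pow A n \<Longrightarrow> y \<in> A \<Longrightarrow> x * y \<in> ideal_pow A (Suc n)"
  unfolding ideal_pow_Suc by (rule ideal_prod_incl)

lemma power_in_ideal_pow: "x \<in> A \<Longrightarrow> x ^ n \<in> ideal_pow A n"
  by (induction n) (auto simp: ideal_pow_0 mult.commute[of x] intro: ideal_pow_SucI)

text \<open>\<open>F\<close> is a multiplicative filtration. It will be the filtration by symbolic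
  powers, with \<open>d = 2\<close>.\<close>

lemma ideal_pow_filtration:
  assumes F: "\<And>i. is_ideal (F i)" "F 0 = UNIV"
    "\<And>i j x y. x \<in> F i \<Longrightarrow> y \<in> F j \<Longrightarrow> x * y \<in> F (i + j)"
    and A: "A \<subseteq> F d"
  shows "ideal_pow A n \<subseteq> F (d * n)"
proof (induction n)
  case (Suc n)
  have "x * y \<in> F (d * Suc n)" if "x \<in> ideal_pow A n" "y \<in> A" for x y
    using F(3)[of x "d * n" y d] Suc A that by (auto simp: add.commute)
  then show ?case
    unfolding ideal_pow_Suc by (intro ideal_prod_least F(1))
qed (use F in auto)

text \<open>The elements \<open>y\<close> with \<open>x * y\<close> in the target form an ideal, so
  the induction on \<open>j\<close> only has to check products.\<close>

lemma ideal_pow_add: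
  assumes A: "is_ideal A" and x: "x \<in> ideal_pow A i" and y: "y \<in> ideal_pow A j"
  shows "x * y \<in> ideal_pow A (i + j)"
proof -
  have "ideal_pow A j \<subseteq> {y. x * y \<in> ideal_pow A (i + j)}"
  proof (induction j)
    case 0
    then show ?case using x A by (auto simp: is_idealD is_ideal_pow)
  next
    case (Suc j)
    have "is_ideal {y. x * y \<in> ideal_pow A (i + Suc j)}"
      using is_idealD[OF is_ideal_pow[OF A, of "i + Suc j"]]
      by (simp add: is_ideal_iff distrib_left mult.left_commute)
    moreover have "x * (u * v) \<in> ideal_pow A (i + Suc j)" if "u \<in> ideal_pow A j" "v \<in> A" for u v
      using ideal_pow_SucI[of "x * u" A "i + j" v] Suc that by (auto simp: mult.assoc)
    ultimately show ?case
      unfolding ideal_pow_Suc[of A j] by (intro ideal_prod_least) auto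
  qed
  with y show ?thesis by blast
qed

lemma ideal_pow_Suc_subset: "is_ideal A \<Longrightarrow> ideal_pow A (Suc n) \<subseteq> ideal_pow A n"
  unfolding ideal_pow_Suc by (intro ideal_prod_least) (auto simp: is_ideal_pow is_idealD)

lemma ideal_pow_antimono:
  assumes "is_ideal A" "i \<le> j"
  shows "ideal_pow A j \<subseteq> ideal_pow A i"
  using assms(2)
  by (induction j rule: dec_induct) (use ideal_pow_Suc_subset[OF assms(1)] in auto)

text \<open>Each of the \<open>n\<close> factors from \<open>A\<close> absorbs one \<open>s\<close>.
  This passes from powers of a prime to powers of a smaller ideal at the cost of a denominator;
  \<open>s = 1\<close> is monotonicity.\<close>

lemma ideal_pow_scale:
  assumes B: "is_ideal B" and A: "\<And>x. x \<in> A \<Longrightarrow> s * x \<in> B" and x: "x \<in> ideal_pow A n"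
  shows "s ^ n * x \<in> ideal_pow B n"
proof -
  have "ideal_pow A n \<subseteq> {x. s ^ n * x \<in> ideal_pow B n}"
  proof (induction n)
    case (Suc n)
    have "is_ideal {x. s ^ Suc n * x \<in> ideal_pow B (Suc n)}"
      using is_idealD[OF is_ideal_pow[OF B, of "Suc n"]]
      by (auto simp: is_ideal_iff distrib_left mult.left_commute)
    moreover have "s ^ Suc n * (x * y) \<in> ideal_pow B (Suc n)" if "x \<in> ideal_pow A n" "y \<in> A" for x y
    proof -
      have eq: "s ^ Suc n * (x * y) = (s ^ n * x) * (s * y)" by (simp add: algebra_simps)
      show ?thesis
        unfolding eq using Suc A that by (intro ideal_pow_SucI) auto
    qed
    ultimately show ?case
      unfolding ideal_pow_Suc[of A n] by (intro ideal_prod_least) auto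
  qed (simp add: ideal_pow_0)
  with x show ?thesis by blast
qed

lemma ideal_pow_mono:
  assumes "is_ideal B" "A \<subseteq> B"
  shows "ideal_pow A n \<subseteq> ideal_pow B n"
  using ideal_pow_scale[of B A 1 _ n] assms by auto

text \<open>The summand \<open>a w\<close> is what the cancellation of \<open>a\<close> in the associated graded ring needs.\<close>

lemma ideal_pow_pair_Suc:
  assumes "x \<in> ideal_pow (idl {a, b}) (Suc n)"
  obtains w y where "w \<in> ideal_pow (idl {a, b}) n" "x = a * w + b ^ Suc n * y"
proof -
  let ?N = "\<lambda>n. ideal_pow (idl {a, b}) n"
  let ?M = "\<lambda>n. {a * w + b ^ Suc n * y | w y. w \<in> ?N n}"
  have id: "is_ideal (?N n)" for n by (intro is_ideal_pow is_ideal_idl)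
  have M: "is_ideal (?M n)" for n
    unfolding is_ideal_iff
  proof (intro conjI ballI allI)
    show "0 \<in> ?M n"
      by (rule CollectI, rule exI[of _ 0], rule exI[of _ 0]) (simp add: is_idealD[OF id])
    show "u + v \<in> ?M n" if uv: "u \<in> ?M n" "v \<in> ?M n" for u v
    proof -
      from uv obtain c d c' d' where "u = a * c + b ^ Suc n * d" "v = a * c' + b ^ Suc n * d'"
        "c \<in> ?N n" "c' \<in> ?N n" by blast
      moreover from this have "u + v = a * (c + c') + b ^ Suc n * (d + d')" "c + c' \<in> ?N n"
        by (simp_all add: algebra_simps is_idealD[OF id])
      ultimately show ?thesis by blast
    qed
    show "r * u \<in> ?M n" if u: "u \<in> ?M n" for u r
    proof -
      from u obtain c d where "u = a * c + b ^ Suc n * d" "c \<in> ?N n" by blast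
      moreover from this have "r * u = a * (r * c) + b ^ Suc n * (r * d)" "r * c \<in> ?N n"
        by (simp_all add: algebra_simps is_idealD[OF id])
      ultimately show ?thesis by blast
    qed
  qed
  have "?N (Suc n) \<subseteq> ?M n"
  proof (induction n)
    case 0
    show ?case
    proof
      fix z assume "z \<in> ?N (Suc 0)"
      then have "z \<in> idl {a, b}" by (simp only: ideal_pow_1[OF is_ideal_idl])
      then obtain c d where "z = a * c + b * d" by (rule idl_pairD)
      then show "z \<in> ?M 0" by (auto simp: ideal_pow_0)
    qed
  next
    case (Suc n)
    have "u * v \<in> ?M (Suc n)" if u: "u \<in> ?N (Suc n)" and v: "v \<in> idl {a, b}" for u v
    proof -
      obtain c d where v: "v = a * c + b * d" using v by (rule idl_pairD)
      obtain w y where w: "w \<in> ?N n" "u = a * w + b ^ Suc n * y" using u Suc by blast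
      \<comment> \<open>Only in the part of \<open>v\<close> along \<open>b\<close> is
        \<open>u\<close> expanded; along \<open>a\<close> it stays whole, because there the cofactor
        of \<open>a\<close> must lie in the power \<open>Suc n\<close>.\<close>
      have "u * v = a * (c * u + d * (w * b)) + b ^ Suc (Suc n) * (y * d)"
        unfolding v by (subst (2) w(2), simp add: w(2) algebra_simps)
      moreover have "w * b \<in> ?N (Suc n)"
        by (intro ideal_pow_SucI w idl_incl) simp
      then have "c * u + d * (w * b) \<in> ?N (Suc n)"
        using u by (simp add: is_idealD[OF id])
      ultimately show ?thesis by blast
    qed
    then show ?case
      unfolding ideal_pow_Suc[of _ "Suc n"] by (intro ideal_prod_least M)
  qed
  with assms that show ?thesis by blast
qed

section \<open>Finite sums of ideals and weighted sums\<close>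

lemma finsum_ideals:
  assumes "finite S" "\<And>a. a \<in> S \<Longrightarrow> is_ideal (f a)"
  shows "is_ideal (\<Oplus>\<^bsub>ideals_set cring_class_ops\<^esub> a \<in> S. f a)"
    and "a \<in> S \<Longrightarrow> f a \<subseteq> (\<Oplus>\<^bsub>ideals_set cring_class_ops\<^esub> a \<in> S. f a)"
    and "is_ideal I \<Longrightarrow> (\<And>a. a \<in> S \<Longrightarrow> f a \<subseteq> I) \<Longrightarrow> (\<Oplus>\<^bsub>ideals_set cring_class_ops\<^esub> a \<in> S. f a) \<subseteq> I"
proof -
  interpret semiring "ideals_set (cring_class_ops :: 'b ring)"
    by (rule cring.ideals_set_is_semiring[OF cring_class])
  \<comment> \<open>The sum is the least ideal containing all summands. The three claims go through
    one induction, since the step needs the smaller sum to be an ideal and to be least.\<close>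
  have "is_ideal (\<Oplus>\<^bsub>ideals_set cring_class_ops\<^esub> a \<in> S. f a) \<and>
    (\<forall>a\<in>S. f a \<subseteq> (\<Oplus>\<^bsub>ideals_set cring_class_ops\<^esub> a \<in> S. f a)) \<and>
    (\<forall>I. is_ideal I \<longrightarrow> (\<forall>a\<in>S. f a \<subseteq> I) \<longrightarrow> (\<Oplus>\<^bsub>ideals_set cring_class_ops\<^esub> a \<in> S. f a) \<subseteq> I)"
    using assms
  proof (induction S rule: finite_induct)
    case empty
    have "(\<Oplus>\<^bsub>ideals_set cring_class_ops\<^esub> a \<in> {}. f a) = {0}"
      by (simp add: finsum_empty) (simp add: ideals_set_def class_simps)
    then show ?case by (auto simp: is_ideal_iff)
  next
    case (insert x S)
    let ?s = "(\<Oplus>\<^bsub>ideals_set cring_class_ops\<^esub> a \<in> S. f a)"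
    have IH: "is_ideal ?s" "\<And>a. a \<in> S \<Longrightarrow> f a \<subseteq> ?s"
      "\<And>I. is_ideal I \<Longrightarrow> \<forall>a\<in>S. f a \<subseteq> I \<Longrightarrow> ?s \<subseteq> I"
      using insert by auto
    have fx: "is_ideal (f x)" using insert by simp
    have "(\<Oplus>\<^bsub>ideals_set cring_class_ops\<^esub> a \<in> insert x S. f a) = f x \<oplus>\<^bsub>ideals_set cring_class_ops\<^esub> ?s"
      using insert by (intro finsum_insert) (auto simp: ideals_set_def)
    also have "\<dots> = {u + v | u v. u \<in> f x \<and> v \<in> ?s}"
      by (auto simp: ideals_set_def set_add_def set_mult_def class_simps)
    finally have eq: "(\<Oplus>\<^bsub>ideals_set cring_class_ops\<^esub> a \<in> insert x S. f a) = {u + v | u v. u \<in> f x \<and> v \<in> ?s}" .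
    have sum: "is_ideal {u + v | u v. u \<in> f x \<and> v \<in> ?s}"
      unfolding is_ideal_iff
    proof (intro conjI ballI allI)
      show "0 \<in> {u + v | u v. u \<in> f x \<and> v \<in> ?s}"
        by (rule CollectI, rule exI[of _ 0], rule exI[of _ 0]) (simp add: is_idealD fx IH)
      show "a + b \<in> {u + v | u v. u \<in> f x \<and> v \<in> ?s}"
        if ab: "a \<in> {u + v | u v. u \<in> f x \<and> v \<in> ?s}" "b \<in> {u + v | u v. u \<in> f x \<and> v \<in> ?s}" for a b
      proof -
        from ab obtain u v u' v' where "a = u + v" "b = u' + v'" "u \<in> f x" "u' \<in> f x" "v \<in> ?s" "v' \<in> ?s"
          by blast
        moreover from this have "a + b = (u + u') + (v + v')" "u + u' \<in> f x" "v + v' \<in> ?s"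
          by (simp_all add: algebra_simps is_idealD fx IH)
        ultimately show ?thesis by blast
      qed
      show "r * a \<in> {u + v | u v. u \<in> f x \<and> v \<in> ?s}" if a: "a \<in> {u + v | u v. u \<in> f x \<and> v \<in> ?s}" for r a
      proof -
        from a obtain u v where "a = u + v" "u \<in> f x" "v \<in> ?s" by blast
        moreover from this have "r * a = r * u + r * v" "r * u \<in> f x" "r * v \<in> ?s"
          by (simp_all add: algebra_simps is_idealD fx IH)
        ultimately show ?thesis by blast
      qed
    qed
    have x: "f x \<subseteq> {u + v | u v. u \<in> f x \<and> v \<in> ?s}"
      using is_idealD(1)[OF IH(1)] by force
    have s: "?s \<subseteq> {u + v | u v. u \<in> f x \<and> v \<in> ?s}"
      using is_idealD(1)[OF fx] by force
    have least: "{u + v | u v. u \<in> f x \<and> v \<in> ?s} \<subseteq> I"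
      if "is_ideal I" "\<forall>a\<in>insert x S. f a \<subseteq> I" for I
      using IH(3)[of I] that is_idealD(2)[of I] by blast
    show ?case
      unfolding eq
    proof (intro conjI ballI allI impI sum least)
      fix a assume "a \<in> insert x S"
      then consider "a = x" | "a \<in> S" by blast
      then show "f a \<subseteq> {u + v | u v. u \<in> f x \<and> v \<in> ?s}"
        by cases (use x in simp, use order_trans[OF IH(2) s] in simp)
    qed (assumption, erule (1) bspec)
  qed
  then show "is_ideal (\<Oplus>\<^bsub>ideals_set cring_class_ops\<^esub> a \<in> S. f a)"
    "a \<in> S \<Longrightarrow> f a \<subseteq> (\<Oplus>\<^bsub>ideals_set cring_class_ops\<^esub> a \<in> S. f a)"
    "is_ideal I \<Longrightarrow> (\<And>a. a \<in> S \<Longrightarrow> f a \<subseteq> I) \<Longrightarrow> (\<Oplus>\<^bsub>ideals_set cring_class_ops\<^esub> a \<in> S. f a) \<subseteq> I"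
    by blast+
qed

lemma finite_weights: "finite {(a1, a2). a1 + 2 * a2 = (n::nat)}"
  by (rule finite_subset[of _ "{..n} \<times> {..n}"]) auto

context
  fixes A B :: "'a::comm_ring_1 set"
  assumes A: "is_ideal A" and B: "is_ideal B"
begin

lemma is_ideal_weighted_summand:
  "is_ideal (ideal_pow A i \<otimes>\<^bsub>ideals_set cring_class_ops\<^esub> ideal_pow B j)"
  using is_ideal_prod[OF is_ideal_pow[OF A, of i] is_ideal_pow[OF B, of j]]
  by (simp only: ideals_set_mult)

lemma is_ideal_weighted_sum: "is_ideal (weighted_sum A B n)"
  unfolding weighted_sum_def by (intro finsum_ideals(1) finite_weights is_ideal_weighted_summand)

lemma weighted_sum_incl:
  assumes "i + 2 * j = n" "x \<in> ideal_pow A i" "y \<in> ideal_pow B j"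
  shows "x * y \<in> weighted_sum A B n"
proof -
  let ?f = "\<lambda>a. ideal_pow A (fst a) \<otimes>\<^bsub>ideals_set cring_class_ops\<^esub> ideal_pow B (snd a)"
  have "x * y \<in> ?f (i, j)"
    using ideal_prod_incl[OF assms(2,3)] by (simp only: ideals_set_mult fst_conv snd_conv)
  also have "\<dots> \<subseteq> weighted_sum A B n"
    unfolding weighted_sum_def
    by (rule finsum_ideals(2)[OF finite_weights is_ideal_weighted_summand]) (use assms in auto)
  finally show ?thesis .
qed

lemma weighted_sum_least:
  assumes "is_ideal I"
    and "\<And>i j x y. i + 2 * j = n \<Longrightarrow> x \<in> ideal_pow A i \<Longrightarrow> y \<in> ideal_pow B j \<Longrightarrow> x * y \<in> I"
  shows "weighted_sum A B n \<subseteq> I"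
  unfolding weighted_sum_def
proof (rule finsum_ideals(3)[OF finite_weights is_ideal_weighted_summand assms(1)])
  fix a :: "nat \<times> nat" assume "a \<in> {(a1, a2). a1 + 2 * a2 = n}"
  then show "ideal_pow A (fst a) \<otimes>\<^bsub>ideals_set cring_class_ops\<^esub> ideal_pow B (snd a) \<subseteq> I"
    unfolding ideals_set_mult by (intro ideal_prod_least assms) auto
qed

end

section \<open>Images of ideals under ring homomorphisms\<close>

locale ring_morphism =
  fixes h :: "'a::comm_ring_1 \<Rightarrow> 'b::comm_ring_1"
  assumes add: "h (x + y) = h x + h y" and mult: "h (x * y) = h x * h y"
begin

lemma zero: "h 0 = 0"
  using add[of 0 0] by simp

lemma uminus: "h (- x) = - h x"
  using add[of x "- x"] by (simp add: zero minus_unique)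

lemma diff: "h (x - y) = h x - h y"
  using add[of x "- y"] by (simp add: uminus)

lemma vimage_ideal: "is_ideal J \<Longrightarrow> is_ideal (h -` J)"
  by (simp add: is_ideal_iff zero add mult)

lemma image_idl_subset: "h ` idl S \<subseteq> idl (h ` S)"
proof -
  have "idl S \<subseteq> h -` idl (h ` S)"
    by (intro idl_least vimage_ideal is_ideal_idl) (auto intro: idl_incl)
  then show ?thesis by blast
qed

lemma image_pow_subset:
  assumes "is_ideal B" "h ` A \<subseteq> B"
  shows "h ` ideal_pow A n \<subseteq> ideal_pow B n"
proof -
  have "ideal_pow A n \<subseteq> h -` ideal_pow B n"
  proof (induction n)
    case (Suc n)
    have "h x * h y \<in> ideal_pow B (Suc n)" if "x \<in> ideal_pow A n" "y \<in> A" for x y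
      using Suc assms that by (intro ideal_pow_SucI) auto
    then show ?case
      unfolding ideal_pow_Suc[of A]
      by (intro ideal_prod_least vimage_ideal is_ideal_pow assms) (simp add: mult)
  qed (simp add: ideal_pow_0)
  then show ?thesis by blast
qed

lemma image_weighted_sum_subset:
  assumes "is_ideal A" "is_ideal B" "is_ideal A'" "is_ideal B'" "h ` A \<subseteq> A'" "h ` B \<subseteq> B'"
  shows "h ` weighted_sum A B n \<subseteq> weighted_sum A' B' n"
proof -
  have "h x * h y \<in> weighted_sum A' B' n"
    if "i + 2 * j = n" "x \<in> ideal_pow A i" "y \<in> ideal_pow B j" for i j x y
    using image_pow_subset[of A' A i] image_pow_subset[of B' B j] that assms
    by (intro weighted_sum_incl) auto
  then have "weighted_sum A B n \<subseteq> h -` weighted_sum A' B' n"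
    using assms by (intro weighted_sum_least vimage_ideal is_ideal_weighted_sum) (auto simp: mult)
  then show ?thesis by blast
qed

lemma image_ideal:
  assumes "surj h" "is_ideal I"
  shows "is_ideal (h ` I)"
  unfolding is_ideal_iff
proof (intro conjI ballI allI)
  show "0 \<in> h ` I" using zero is_idealD(1)[OF assms(2)] by (metis image_eqI)
  show "a + b \<in> h ` I" if ab: "a \<in> h ` I" "b \<in> h ` I" for a b
  proof -
    from ab obtain x y where xy: "a = h x" "b = h y" "x \<in> I" "y \<in> I" by blast
    then show ?thesis using is_idealD(2)[OF assms(2), of x y] add[of x y] by (metis image_eqI)
  qed
  show "r * a \<in> h ` I" if a: "a \<in> h ` I" for a r
  proof -
    from a assms(1) obtain x s where "a = h x" "x \<in> I" "r = h s" by (metis imageE surjD)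
    then show ?thesis using is_idealD(3)[OF assms(2), of x s] mult[of s x] by (metis image_eqI)
  qed
qed

lemma image_idl: "surj h \<Longrightarrow> h ` idl S = idl (h ` S)"
  using image_idl_subset[of S] idl_least[OF image_ideal[OF _ is_ideal_idl[of S]], of "h ` S"]
  by (auto intro: idl_incl)

lemma pow_image_subset:
  assumes "surj h" "is_ideal A"
  shows "ideal_pow (h ` A) n \<subseteq> h ` ideal_pow A n"
proof (induction n)
  case (Suc n)
  have "x * y \<in> h ` ideal_pow A (Suc n)" if xy: "x \<in> ideal_pow (h ` A) n" "y \<in> h ` A" for x y
  proof -
    from xy Suc obtain u v where "x = h u" "u \<in> ideal_pow A n" "y = h v" "v \<in> A" by blast
    then show ?thesis using ideal_pow_SucI[of u A n v] mult[of u v] by (metis image_eqI)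
  qed
  then show ?case
    unfolding ideal_pow_Suc[of "h ` A"] by (intro ideal_prod_least image_ideal is_ideal_pow assms)
qed (use assms in \<open>simp add: ideal_pow_0\<close>)

text \<open>Surjectivity makes images of ideals ideals, so both inclusions follow from leastness of
  the sums. This will identify \<open>initial_I\<close> with the reduction of
  \<open>cal_I\<close>.\<close>

lemma image_weighted_sum:
  assumes "surj h" "is_ideal A" "is_ideal B"
  shows "h ` weighted_sum A B n = weighted_sum (h ` A) (h ` B) n"
proof
  show "h ` weighted_sum A B n \<subseteq> weighted_sum (h ` A) (h ` B) n"
    using assms by (intro image_weighted_sum_subset image_ideal) auto
  have "x * y \<in> h ` weighted_sum A B n"
    if ij: "i + 2 * j = n" and xy: "x \<in> ideal_pow (h ` A) i" "y \<in> ideal_pow (h ` B) j" for i j x y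
  proof -
    from xy pow_image_subset[OF assms(1)] assms obtain u v
      where "x = h u" "u \<in> ideal_pow A i" "y = h v" "v \<in> ideal_pow B j" by blast
    then show ?thesis
      using weighted_sum_incl[OF assms(2,3) ij, of u v] mult[of u v] by (metis image_eqI)
  qed
  then show "weighted_sum (h ` A) (h ` B) n \<subseteq> h ` weighted_sum A B n"
    using assms by (intro weighted_sum_least image_ideal is_ideal_weighted_sum)
qed

end

section \<open>Symbolic powers and regular sequences\<close>

context
  fixes P :: "'a::idom set"
  assumes prime: "primeideal P cring_class_ops"
begin

lemma prime_is_ideal: "is_ideal P"
  using prime by (simp add: primeideal_def)

lemma prime_mult: "s \<notin> P \<Longrightarrow> t \<notin> P \<Longrightarrow> s * t \<notin> P"
  using primeideal.I_prime[OF prime, of s t] by (auto simp: class_simps)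

lemma one_notin_prime: "1 \<notin> P"
  using ideal.one_imp_carrier[OF prime_is_ideal] primeideal.I_notcarr[OF prime]
  by (auto simp: class_simps)

lemma prime_power: "s \<notin> P \<Longrightarrow> s ^ n \<notin> P"
  by (induction n) (auto simp: one_notin_prime prime_mult)

text \<open>The fractions with numerator in \<open>P^n\<close> and denominator outside
  \<open>P\<close> already form an ideal of the localization, so they are the whole extension of
  \<open>P^n\<close>. Clearing denominators then gives a criterion inside the ring.\<close>

lemma symbolic_power_iff: "r \<in> symbolic_power P n \<longleftrightarrow> (\<exists>s. s \<notin> P \<and> s * r \<in> ideal_pow P n)"
proof -
  let ?I = "ideal_pow P n"
  let ?f = "\<lambda>a :: 'a. Fraction_Field.Fract a 1"
  let ?J = "{Fraction_Field.Fract a s | a s. a \<in> ?I \<and> s \<notin> P}"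
  interpret L: cring "localization P" by (rule localization_cring[OF prime])
  have I: "is_ideal ?I" by (intro is_ideal_pow prime_is_ideal)
  have nz: "s \<noteq> 0" if "s \<notin> P" for s
    using that is_idealD(1)[OF prime_is_ideal] by auto
  have car: "carrier (localization P) = {Fraction_Field.Fract a s | a s. s \<notin> P}"
    by (simp add: localization_def)
  have fcar: "?f a \<in> carrier (localization P)" for a
    unfolding car using one_notin_prime by blast
  interpret I: ideal "Idl\<^bsub>localization P\<^esub> (?f ` ?I)" "localization P"
    by (rule L.genideal_ideal) (use fcar in auto)
  have sub: "?f ` ?I \<subseteq> Idl\<^bsub>localization P\<^esub> (?f ` ?I)"
    by (rule L.genideal_self) (use fcar in auto)
  have Jadd: "x + y \<in> ?J" if xy: "x \<in> ?J" "y \<in> ?J" for x y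
  proof -
    from xy obtain a s b t where "x = Fraction_Field.Fract a s" "a \<in> ?I" "s \<notin> P"
      "y = Fraction_Field.Fract b t" "b \<in> ?I" "t \<notin> P" by blast
    moreover from this have "x + y = Fraction_Field.Fract (a * t + b * s) (s * t)"
      using nz by simp
    moreover have "a * t + b * s \<in> ?I" "s * t \<notin> P"
      using calculation by (simp_all add: is_idealD[OF I] prime_mult)
    ultimately show ?thesis by blast
  qed
  have Jmult: "x * y \<in> ?J" if xy: "x \<in> carrier (localization P)" "y \<in> ?J" for x y
  proof -
    from xy obtain a s b t where "x = Fraction_Field.Fract a s" "s \<notin> P"
      "y = Fraction_Field.Fract b t" "b \<in> ?I" "t \<notin> P" unfolding car by blast
    moreover from this have "x * y = Fraction_Field.Fract (a * b) (s * t)" by simp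
    moreover have "a * b \<in> ?I" "s * t \<notin> P"
      using calculation by (simp_all add: is_idealD[OF I] prime_mult)
    ultimately show ?thesis by blast
  qed
  have J0: "0 \<in> ?J"
    using one_notin_prime is_idealD(1)[OF I] unfolding Zero_fract_def by blast
  have Jcar: "?J \<subseteq> carrier (localization P)"
    unfolding car by blast
  \<comment> \<open>The record \<open>localization P\<close> has no negation of its own; its
    additive inverse is found by uniqueness.\<close>
  have minus: "\<ominus>\<^bsub>localization P\<^esub> x = - x" if "x \<in> carrier (localization P)" for x
  proof -
    from that obtain a s where x: "x = Fraction_Field.Fract a s" "s \<notin> P" unfolding car by blast
    have "- x = Fraction_Field.Fract (- a) s" using x by simp
    then have "- x \<in> carrier (localization P)" unfolding car using x by blast
    moreover have "- x \<oplus>\<^bsub>localization P\<^esub> x = \<zero>\<^bsub>localization P\<^esub>"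
      by (simp add: localization_def)
    ultimately show ?thesis using L.minus_equality that by blast
  qed
  have Jneg: "- x \<in> ?J" if x: "x \<in> ?J" for x
  proof -
    from x obtain a s where "x = Fraction_Field.Fract a s" "a \<in> ?I" "s \<notin> P" by blast
    moreover from this have "- x = Fraction_Field.Fract (- a) s" by simp
    ultimately show ?thesis using is_idealD(5)[OF I] by blast
  qed
  have "ideal ?J (localization P)"
  proof (rule idealI)
    show "ring (localization P)" by (rule L.ring_axioms)
    show "subgroup ?J (add_monoid (localization P))"
    proof (rule L.add.subgroupI)
      show "?J \<subseteq> carrier (localization P)" by (rule Jcar)
      show "?J \<noteq> {}" using J0 by blast
      show "\<ominus>\<^bsub>localization P\<^esub> a \<in> ?J" if "a \<in> ?J" for a
        unfolding minus[OF subsetD[OF Jcar that]] by (rule Jneg[OF that])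
      show "a \<oplus>\<^bsub>localization P\<^esub> b \<in> ?J" if "a \<in> ?J" "b \<in> ?J" for a b
        using Jadd[OF that] by (simp add: localization_def)
    qed
    show "x \<otimes>\<^bsub>localization P\<^esub> a \<in> ?J" if "a \<in> ?J" "x \<in> carrier (localization P)" for a x
      using Jmult[OF that(2,1)] by (simp add: localization_def)
    then show "a \<otimes>\<^bsub>localization P\<^esub> x \<in> ?J" if "a \<in> ?J" "x \<in> carrier (localization P)" for a x
      using that(1) unfolding L.m_comm[OF subsetD[OF Jcar that(1)] that(2)] using that(2) by blast
  qed
  moreover have "?f ` ?I \<subseteq> ?J" using one_notin_prime by blast
  ultimately have le: "Idl\<^bsub>localization P\<^esub> (?f ` ?I) \<subseteq> ?J" by (rule L.genideal_minimal)
  show ?thesis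
  proof
    assume "r \<in> symbolic_power P n"
    then have "?f r \<in> ?J" using le by (auto simp: symbolic_power_def)
    then obtain a s where "?f r = Fraction_Field.Fract a s" "a \<in> ?I" "s \<notin> P" by blast
    then show "\<exists>s. s \<notin> P \<and> s * r \<in> ?I"
      using nz by (auto simp: eq_fract mult.commute intro!: exI[of _ s])
  next
    assume "\<exists>s. s \<notin> P \<and> s * r \<in> ?I"
    then obtain s where s: "s \<notin> P" "s * r \<in> ?I" by blast
    have "Fraction_Field.Fract 1 s \<in> carrier (localization P)" unfolding car using s by blast
    moreover have "?f (s * r) \<in> Idl\<^bsub>localization P\<^esub> (?f ` ?I)" using sub s by blast
    ultimately have "Fraction_Field.Fract 1 s \<otimes>\<^bsub>localization P\<^esub> ?f (s * r) \<in> Idl\<^bsub>localization P\<^esub> (?f ` ?I)"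
      by (rule I.I_l_closed[rotated])
    moreover have "Fraction_Field.Fract 1 s \<otimes>\<^bsub>localization P\<^esub> ?f (s * r) = ?f r"
      using nz[OF s(1)] by (simp add: localization_def eq_fract)
    ultimately show "r \<in> symbolic_power P n" by (simp add: symbolic_power_def)
  qed
qed

lemma is_ideal_symbolic_power: "is_ideal (symbolic_power P n)"
  by (rule symbolic_power_ideal[OF prime])

lemma pow_subset_symbolic_power: "ideal_pow P n \<subseteq> symbolic_power P n"
  using one_notin_prime by (auto simp: symbolic_power_iff intro!: exI[of _ 1])

lemma symbolic_power_0: "symbolic_power P 0 = UNIV"
  using one_notin_prime by (auto simp: symbolic_power_iff ideal_pow_0)

text \<open>Primality: if \<open>s * r\<close> lies in \<open>P\<close> and \<open>s\<close> does
  not, then \<open>r\<close> does.\<close>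

lemma symbolic_power_1: "symbolic_power P (Suc 0) = P"
proof
  show "symbolic_power P (Suc 0) \<subseteq> P"
    using prime_mult by (auto simp: symbolic_power_iff ideal_pow_1 prime_is_ideal) blast
  show "P \<subseteq> symbolic_power P (Suc 0)"
    using pow_subset_symbolic_power[of "Suc 0"] by (simp add: ideal_pow_1 prime_is_ideal)
qed

lemma symbolic_power_mult:
  assumes "x \<in> symbolic_power P i" "y \<in> symbolic_power P j"
  shows "x * y \<in> symbolic_power P (i + j)"
proof -
  from assms obtain s t where "s \<notin> P" "s * x \<in> ideal_pow P i" "t \<notin> P" "t * y \<in> ideal_pow P j"
    by (auto simp: symbolic_power_iff)
  then have "s * t \<notin> P" "(s * x) * (t * y) \<in> ideal_pow P (i + j)"
    by (simp_all add: prime_mult ideal_pow_add prime_is_ideal)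
  then show ?thesis
    by (auto simp: symbolic_power_iff ac_simps intro!: exI[of _ "s * t"])
qed

lemma symbolic_power_antimono: "i \<le> j \<Longrightarrow> symbolic_power P j \<subseteq> symbolic_power P i"
  using ideal_pow_antimono[OF prime_is_ideal, of i j] by (fastforce simp: symbolic_power_iff)

text \<open>The two denominators multiply. This later allows division by \<open>x1\<close> to put
  \<open>f2\<close> into the second symbolic power.\<close>

lemma symbolic_power_saturated:
  assumes "s \<notin> P" "s * r \<in> symbolic_power P n"
  shows "r \<in> symbolic_power P n"
proof -
  from assms obtain t where "t \<notin> P" "t * (s * r) \<in> ideal_pow P n"
    by (auto simp: symbolic_power_iff)
  then show ?thesis
    using prime_mult[of t s] assms(1) by (auto simp: symbolic_power_iff mult.assoc intro!: exI[of _ "t * s"])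
qed

lemma weighted_sum_subset_symbolic_power:
  assumes "A \<subseteq> P" "B \<subseteq> symbolic_power P 2" "is_ideal A" "is_ideal B"
  shows "weighted_sum A B n \<subseteq> symbolic_power P n"
proof (rule weighted_sum_least[OF assms(3,4) is_ideal_symbolic_power])
  fix i j x y assume ij: "i + 2 * j = n" and x: "x \<in> ideal_pow A i" and y: "y \<in> ideal_pow B j"
  have "x \<in> symbolic_power P i"
    using x ideal_pow_mono[OF prime_is_ideal assms(1)] pow_subset_symbolic_power by blast
  moreover have "ideal_pow B j \<subseteq> symbolic_power P (2 * j)"
    by (rule ideal_pow_filtration)
      (simp_all add: is_ideal_symbolic_power symbolic_power_0 symbolic_power_mult assms)
  ultimately show "x * y \<in> symbolic_power P n"
    using symbolic_power_mult[of x i y "2 * j"] y ij by auto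
qed

section \<open>A regular sequence generating the prime up to a denominator\<close>

context
  fixes a b c :: 'a
  assumes ab: "a \<in> P" "b \<in> P" "a \<noteq> 0"
    and regular: "\<And>h. a dvd b * h \<Longrightarrow> a dvd h"
    and c: "c \<notin> P" "\<And>x. x \<in> P \<Longrightarrow> c * x \<in> idl {a, b}"
begin

text \<open>The factor \<open>c ^ Suc n\<close> moves \<open>P ^ Suc n\<close> into the same power
  of \<open>idl {a, b}\<close>, where \<open>ideal_pow_pair_Suc\<close> splits off \<open>a\<close>.
  The instance used later is \<open>a = g3\<close>, \<open>b = g1\<close>,
  \<open>c = x2\<close>.\<close>

lemma symbolic_power_SucE:
  assumes "x \<in> symbolic_power P (Suc n)"
  obtains s w y where "s \<notin> P" "w \<in> ideal_pow P n" "s * x = a * w + b ^ Suc n * y"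
proof -
  from assms obtain s where s: "s \<notin> P" "s * x \<in> ideal_pow P (Suc n)"
    by (auto simp: symbolic_power_iff)
  have "c ^ Suc n * (s * x) \<in> ideal_pow (idl {a, b}) (Suc n)"
    by (rule ideal_pow_scale[OF is_ideal_idl c(2) s(2)])
  then obtain w y where wy: "w \<in> ideal_pow (idl {a, b}) n" "c ^ Suc n * (s * x) = a * w + b ^ Suc n * y"
    by (rule ideal_pow_pair_Suc)
  have "idl {a, b} \<subseteq> P" by (intro idl_least prime_is_ideal) (use ab in auto)
  then have "w \<in> ideal_pow P n" using ideal_pow_mono[OF prime_is_ideal] wy(1) by blast
  moreover have "c ^ Suc n * s \<notin> P" by (intro prime_mult prime_power c s)
  ultimately show ?thesis using that[of "c ^ Suc n * s" w y] wy(2)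
    by (simp add: mult.assoc)
qed

lemma regular_power: "a dvd b ^ n * h \<Longrightarrow> a dvd h"
  by (induction n) (auto simp: mult.assoc dest: regular)

text \<open>The initial form of \<open>a\<close> is a nonzerodivisor on the associated graded ring:
  regularity makes the cofactor \<open>y\<close> of \<open>b ^ Suc n\<close> a multiple of
  \<open>a\<close>, and then \<open>a\<close> cancels.\<close>

lemma symbolic_power_cancel:
  assumes "a * z \<in> symbolic_power P (Suc n)"
  shows "z \<in> symbolic_power P n"
proof -
  obtain s w y where s: "s \<notin> P" and w: "w \<in> ideal_pow P n" and eq: "s * (a * z) = a * w + b ^ Suc n * y"
    using symbolic_power_SucE[OF assms] .
  from eq have "b ^ Suc n * y = a * (s * z - w)" by (simp add: algebra_simps)
  then have "a dvd y" using regular_power[of "Suc n" y] by (metis dvd_triv_left)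
  then obtain y' where "y = a * y'" ..
  then have "a * (s * z) = a * (w + b ^ Suc n * y')" using eq by (simp add: algebra_simps)
  then have "s * z = w + b ^ n * b * y'" using ab(3) by (simp add: ac_simps)
  moreover have "b ^ n * b * y' \<in> ideal_pow P n"
    using is_idealD[OF is_ideal_pow[OF prime_is_ideal, of n]] power_in_ideal_pow[OF ab(2)] by simp
  ultimately have "s * z \<in> ideal_pow P n"
    using w is_idealD(2)[OF is_ideal_pow[OF prime_is_ideal, of n]] by simp
  with s show ?thesis by (auto simp: symbolic_power_iff)
qed

lemma symbolic_power_cancel_power: "a ^ k * z \<in> symbolic_power P (k + n) \<Longrightarrow> z \<in> symbolic_power P n"
  by (induction k) (auto simp: mult.assoc dest: symbolic_power_cancel)

text \<open>In the graded ring modulo \<open>a\<close>, the class of \<open>b ^ n\<close> has no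
  torsion over the quotient by \<open>P\<close>: cancelling \<open>b ^ n\<close> modulo
  \<open>a\<close> leaves \<open>s * y\<close> in the ideal of \<open>a\<close> and
  \<open>b\<close>.\<close>

lemma symbolic_power_initial:
  assumes "b ^ n * y + a * z \<in> symbolic_power P (Suc n)"
  shows "y \<in> P"
proof -
  obtain s w u where s: "s \<notin> P" and w: "w \<in> ideal_pow P n"
    and eq: "s * (b ^ n * y + a * z) = a * w + b ^ Suc n * u"
    using symbolic_power_SucE[OF assms] .
  have "b ^ n * (s * y - b * u) = a * (w - s * z)" using eq by (simp add: algebra_simps)
  then have "a dvd s * y - b * u" using regular_power[of n "s * y - b * u"] by (metis dvd_triv_left)
  then obtain v where "s * y - b * u = a * v" ..
  then have "s * y = b * u + a * v" by (simp add: algebra_simps)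
  then have "s * y \<in> P" using is_idealD[OF prime_is_ideal] ab by simp
  with s show ?thesis using prime_mult by blast
qed

end

end

section \<open>Power series in three variables\<close>

lemma emb2_nth [simp]: "emb2 p $ j = fps_of_poly (coeff p j)"
  by (simp add: emb2_def)

lemma emb3_nth [simp]: "emb3 p $ i = emb2 (coeff p i)"
  by (simp add: emb3_def)

lemma emb2_add: "emb2 (p + q) = emb2 p + emb2 q"
  by (rule fps_ext) (simp add: fps_of_poly_add)

lemma emb2_mult: "emb2 (p * q) = emb2 p * emb2 q"
  by (rule fps_ext) (simp add: fps_mult_nth coeff_mult fps_of_poly_sum fps_of_poly_mult atLeast0AtMost)

interpretation emb2: ring_morphism emb2
  by unfold_locales (simp_all add: emb2_add emb2_mult)

lemma emb2_sum: "emb2 (sum f A) = (\<Sum>a\<in>A. emb2 (f a))"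
  by (induction A rule: infinite_finite_induct) (simp_all add: emb2.zero emb2_add)

interpretation emb3: ring_morphism emb3
proof
  show "emb3 (p + q) = emb3 p + emb3 q" for p q :: "'a poly poly poly"
    by (rule fps_ext) (simp add: emb2_add)
  show "emb3 (p * q) = emb3 p * emb3 q" for p q :: "'a poly poly poly"
    by (rule fps_ext) (simp add: fps_mult_nth coeff_mult emb2_sum emb2_mult atLeast0AtMost)
qed

lemma emb2_1: "emb2 1 = 1"
  by (rule fps_ext) simp

lemma emb3_1: "emb3 1 = 1"
  by (rule fps_ext) (simp add: emb2_1 emb2.zero)

lemma emb2_power: "emb2 (p ^ n) = emb2 p ^ n"
  by (induction n) (simp_all add: emb2_1 emb2_mult)

lemma emb3_power: "emb3 (p ^ n) = emb3 p ^ n"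
  by (induction n) (simp_all add: emb3_1 emb3.mult)

lemmas emb3_hom = emb3.add emb3.diff emb3.uminus emb3.mult emb3_power emb3_1 emb3.zero

interpretation poly_mod_x1: ring_morphism poly_mod_x1
  by unfold_locales (simp_all add: poly_mod_x1_def coeff_mult)

lemma poly_mod_x1_1: "poly_mod_x1 1 = 1"
  by (simp add: poly_mod_x1_def)

lemma poly_mod_x1_power: "poly_mod_x1 (p ^ n) = poly_mod_x1 p ^ n"
  by (induction n) (simp_all add: poly_mod_x1_1 poly_mod_x1.mult)

lemma poly_mod_x1_variables:
  "poly_mod_x1 x1 = 0" "poly_mod_x1 x2 = y2" "poly_mod_x1 x3 = y3"
  by (simp_all add: poly_mod_x1_def x1_def x2_def x3_def y2_def y3_def)

lemmas poly_mod_x1_hom = poly_mod_x1.add poly_mod_x1.diff poly_mod_x1.uminus poly_mod_x1.mult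
  poly_mod_x1_power poly_mod_x1_1 poly_mod_x1.zero poly_mod_x1_variables

interpretation fps_mod_x1: ring_morphism fps_mod_x1
  by unfold_locales (simp_all add: fps_mod_x1_def)

interpretation phi: ring_morphism "phi q m"
  by unfold_locales (simp_all add: phi_add phi_mult)

lemma emb2_variables: "emb2 y2 = fps_X" "emb2 y3 = fps_const fps_X"
  by (rule fps_ext; simp add: y2_def y3_def coeff_pCons split: nat.split)+

text \<open>
  The hypothesis divides with remainder modulo \<open>fps_X\<close>; iterating it determines the coefficients
  of the \<open>W j\<close> one after the other.
\<close>

lemma fps_division:
  fixes H :: "'i \<Rightarrow> 'a::comm_ring_1 fps"
  assumes step: "\<And>F. F \<in> M \<Longrightarrow>
      \<exists>w. (\<forall>j\<in>J. w j \<in> C j) \<and> (\<exists>G\<in>M. F = (\<Sum>j\<in>J. fps_const (w j) * H j) + fps_X * G)"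
    and F: "F \<in> M"
  obtains W where "\<And>j k. j \<in> J \<Longrightarrow> W j $ k \<in> C j" "F = (\<Sum>j\<in>J. W j * H j)"
proof -
  from step obtain w where w: "\<And>F. F \<in> M \<Longrightarrow>
      (\<forall>j\<in>J. w F j \<in> C j) \<and> (\<exists>G\<in>M. F = (\<Sum>j\<in>J. fps_const (w F j) * H j) + fps_X * G)"
    by metis
  then obtain g where g: "\<And>F. F \<in> M \<Longrightarrow> g F \<in> M"
    "\<And>F. F \<in> M \<Longrightarrow> F = (\<Sum>j\<in>J. fps_const (w F j) * H j) + fps_X * g F"
    by metis
  define f where "f k = (g ^^ k) F" for k
  have f: "f k \<in> M" for k
    by (induction k) (use F g in \<open>auto simp: f_def\<close>)
  \<comment> \<open>Only \<open>W 0\<close> is wanted; starting the expansion at the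
    \<open>k\<close>-th remainder \<open>f k\<close> makes the family satisfy a recursion.\<close>
  define W where "W k j = Abs_fps (\<lambda>i. w (f (k + i)) j)" for k j
  \<comment> \<open>\<open>D k\<close> is the error of the expansion from \<open>f k\<close>. By the
    recursion it is divisible by every power of \<open>fps_X\<close>, hence zero.\<close>
  define D where "D k = f k - (\<Sum>j\<in>J. W k j * H j)" for k
  have W: "W k j = fps_const (w (f k) j) + fps_X * W (Suc k) j" for k j
  proof (rule fps_ext)
    show "W k j $ i = (fps_const (w (f k) j) + fps_X * W (Suc k) j) $ i" for i
      by (cases i) (auto simp: W_def)
  qed
  have D: "D k = fps_X * D (Suc k)" for k
  proof -
    have "f k = (\<Sum>j\<in>J. fps_const (w (f k) j) * H j) + fps_X * f (Suc k)"
      using g(2)[OF f, of k] by (simp add: f_def)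
    moreover have "(\<Sum>j\<in>J. W k j * H j) =
        (\<Sum>j\<in>J. fps_const (w (f k) j) * H j) + fps_X * (\<Sum>j\<in>J. W (Suc k) j * H j)"
      by (subst W) (simp only: distrib_right sum.distrib sum_distrib_left mult.assoc)
    moreover have "a = s + x * b \<Longrightarrow> c = s + x * d \<Longrightarrow> a - c = x * (b - d)" for a b c d s x :: "'a fps"
      by (simp add: algebra_simps)
    ultimately show ?thesis unfolding D_def by metis
  qed
  have "D k $ d = 0" for k d
  proof (induction d arbitrary: k)
    case 0
    show ?case by (subst D) simp
  next
    case (Suc d)
    show ?case by (subst D) (simp add: Suc)
  qed
  then have "D 0 = 0" by (intro fps_ext) simp
  then have "F = (\<Sum>j\<in>J. W 0 j * H j)" by (simp add: D_def f_def)
  moreover have "W 0 j $ k \<in> C j" if "j \<in> J" for j k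
    using w[OF f, of k] that by (simp add: W_def)
  ultimately show ?thesis using that by blast
qed

lemma fps_X_dvd_iff: "fps_X dvd F \<longleftrightarrow> F $ 0 = (0 :: 'a::comm_ring_1)"
proof
  assume "F $ 0 = 0"
  then have "F = fps_X * fps_shift 1 F"
    by (intro fps_ext) simp
  then show "fps_X dvd F" by (rule dvdI)
qed auto

lemma monomial_mult_nth:
  "(F * emb3 (x1 ^ a * x2 ^ b * x3 ^ c)) $ i $ j $ k =
     (if a \<le> i \<and> b \<le> j \<and> c \<le> k then F $ (i - a) $ (j - b) $ (k - c) else 0)"
proof -
  have *: "F * emb3 (x1 ^ a * x2 ^ b * x3 ^ c) =
      (F * fps_const (fps_const (fps_X ^ c)) * fps_const (fps_X ^ b)) * fps_X ^ a"
    by (simp add: emb3_hom emb3_variables fps_const_power ac_simps)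
  show ?thesis
    unfolding * by (auto simp: fps_X_power_mult_right_nth)
qed

text \<open>The weight of \<open>x2^(r mod 2) x3^(r div 2)\<close> is congruent to \<open>r m\<close> modulo \<open>2 q + 1\<close>.\<close>

lemma residue_monomials_independent:
  fixes W :: "nat \<Rightarrow> 'k::field fps fps fps"
  assumes coprime: "coprime (2 * q + 1) m"
    and W: "\<And>r i. r < 2 * q + 1 \<Longrightarrow> W r $ i \<in> range (\<lambda>c. fps_const (fps_const c))"
    and P: "(\<Sum>r<2 * q + 1. W r * emb3 (x1 ^ d r * x2 ^ (r mod 2) * x3 ^ (r div 2))) \<in> curve_prime q m"
    and r: "r < 2 * q + 1"
  shows "W r = 0"
proof -
  let ?Y = "\<Sum>r<2 * q + 1. W r * emb3 (x1 ^ d r * x2 ^ (r mod 2) * x3 ^ (r div 2))"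
  have W0: "W r $ i $ j $ k = (if j = 0 \<and> k = 0 then W r $ i $ 0 $ 0 else 0)"
    if "r < 2 * q + 1" for r i j k
    using W[OF that, of i] by auto
  have summand: "(W s * emb3 (x1 ^ d s * x2 ^ (s mod 2) * x3 ^ (s div 2))) $ i $ j $ k =
      (if s = 2 * k + j \<and> j < 2 \<and> d s \<le> i then W s $ (i - d s) $ 0 $ 0 else 0)"
    if "s < 2 * q + 1" for s i j k
  proof -
    have "s mod 2 \<le> j \<and> j - s mod 2 = 0 \<and> s div 2 \<le> k \<and> k - s div 2 = 0 \<longleftrightarrow> s = 2 * k + j \<and> j < 2"
      by auto
    then show ?thesis
      unfolding monomial_mult_nth by (subst W0[OF that]) auto
  qed
  have Y: "?Y $ i $ j $ k = (\<Sum>s<2 * q + 1. if s = 2 * k + j \<and> j < 2 \<and> d s \<le> i then W s $ (i - d s) $ 0 $ 0 else 0)"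
    for i j k
    unfolding fps_sum_nth by (intro sum.cong refl summand) simp
  \<comment> \<open>Equal weights give equal \<open>2 * k + j\<close> modulo
    \<open>2 * q + 1\<close>, as \<open>m\<close> is invertible there. Both values are below
    \<open>2 * q + 1\<close>, so they agree; parity then gives \<open>j\<close> and
    \<open>k\<close>, and the weight gives \<open>i\<close>.\<close>
  have unique: "u = v"
    if cu: "cf ?Y u \<noteq> 0" and cv: "cf ?Y v \<noteq> 0" and wt: "wt q m u = wt q m v" for u v
  proof -
    have dec: "\<exists>s. s < 2 * q + 1 \<and> s = 2 * snd (snd u) + fst (snd u) \<and> fst (snd u) < 2"
      if "cf ?Y u \<noteq> 0" for u
      using that unfolding Y by (rule contrapos_np) (auto intro!: sum.neutral)
    obtain i j k i' j' k' where uv: "u = (i, j, k)" "v = (i', j', k')" by (cases u, cases v)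
    let ?N = "2 * q + 1"
    have lt: "2 * k + j < ?N" "2 * k' + j' < ?N" "j < 2" "j' < 2"
      using dec[OF cu] dec[OF cv] by (auto simp: uv)
    have "?N * i + (?N + m) * j + (?N + 2 * m) * k = ?N * i' + (?N + m) * j' + (?N + 2 * m) * k'"
      using wt by (simp add: uv weight_def)
    then have eq: "?N * (i + j + k) + m * (2 * k + j) = ?N * (i' + j' + k') + m * (2 * k' + j')"
      by (simp add: algebra_simps)
    then have "(m * (2 * k + j)) mod ?N = (m * (2 * k' + j')) mod ?N"
      by (metis mod_mult_self4)
    then have "[m * (2 * k + j) = m * (2 * k' + j')] (mod ?N)" by (simp add: cong_def)
    then have "[2 * k + j = 2 * k' + j'] (mod ?N)"
      using coprime by (simp add: cong_mult_lcancel_nat coprime_commute)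
    then have s: "2 * k + j = 2 * k' + j'"
      using lt by (simp add: cong_def)
    have "j = j'" using s lt(3,4) by presburger
    moreover from this s have "k = k'" by simp
    moreover from eq s have "?N * (i + j + k) = ?N * (i' + j' + k')"
      by (simp only: add_right_cancel)
    then have "i + j + k = i' + j' + k'" by (subst (asm) mult_cancel1) simp
    ultimately have "i = i'" "j = j'" "k = k'" by simp_all
    then show ?thesis by (simp add: uv)
  qed
  \<comment> \<open>No two terms of \<open>?Y\<close> share a weight, so nothing cancels under
    \<open>phi\<close> and each nonzero coefficient would survive.\<close>
  have zero: "cf ?Y u = 0" for u
  proof (rule ccontr)
    assume u: "cf ?Y u \<noteq> 0"
    have "finite {v. wt q m v = wt q m u}"
      by (rule finite_subset[OF _ finite_wt[of q m "wt q m u"]]) auto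
    then have "phi q m ?Y $ (wt q m u) = cf ?Y u"
      unfolding phi_nth
      by (subst sum.remove[of _ u]) (use unique[of _ u] u in \<open>auto intro!: sum.neutral\<close>)
    moreover have "phi q m ?Y = 0" using P by (simp add: curve_prime_eq)
    ultimately show False using u by simp
  qed
  have "W r $ i $ 0 $ 0 = 0" for i
  proof -
    have "?Y $ (i + d r) $ (r mod 2) $ (r div 2) = W r $ i $ 0 $ 0"
      unfolding Y by (subst sum.remove[of _ r]) (use r in \<open>auto intro!: sum.neutral\<close>)
    then show ?thesis using zero[of "(i + d r, r mod 2, r div 2)"] by simp
  qed
  then show ?thesis
    by (intro fps_ext) (subst W0[OF r], simp)
qed

section \<open>The standard basis\<close>

text \<open>The first identity gives \<open>x1 * f2\<close> in the square of the prime. Modulo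
  \<open>g3\<close>, the other two turn \<open>x2 ^ 2 * f2\<close> into
  \<open>- (x1 * g1 ^ 2)\<close> and \<open>x2 * g2\<close> into \<open>x1 * g1\<close>, which
  yields the initial forms.\<close>

lemma f2_eq:
  assumes "q \<ge> 1" "m \<ge> 1"
  shows "x1 * f2 q m = - (g2 q m ^ 2) - x3 ^ (q - 1) * g1 q m * (g3 :: 'k::field poly poly poly)"
    and "x2 ^ 2 * f2 q m = - (x1 * g1 q m ^ 2) + (g3 :: 'k poly poly poly) *
           (2 * x3 ^ q * g1 q m + x3 ^ (2 * q + 1) - x1 ^ (m + q - 1) * x2 ^ 3 * x3 ^ (q - 1))"
    and "x1 * g1 q m = x2 * g2 q m + x3 ^ q * (g3 :: 'k poly poly poly)"
proof -
  \<comment> \<open>Writing \<open>q = Suc p\<close> removes the truncated subtractions; with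
    \<open>X\<close> and \<open>Z\<close> for the symbolic powers of the variables, all exponents
    become numerals.\<close>
  obtain p where q: "q = Suc p" using assms by (cases q) auto
  define X where "X = (x1 :: 'k poly poly poly) ^ (m + p)"
  define Z where "Z = (x3 :: 'k poly poly poly) ^ p"
  have g1: "g1 q m = x1 * X * x2 - x3 * x3 * Z"
    by (simp add: g1_def q X_def Z_def algebra_simps)
  have g2: "g2 q m = x1 * x1 * X - x2 * x3 * Z"
    by (simp add: g2_def q X_def Z_def algebra_simps)
  have "2 * (m + q) + 1 = 3 + (m + p) + (m + p)" "2 * q + 1 = 3 + p + p" by (simp_all add: q)
  then have pow1: "x1 ^ (2 * (m + q) + 1) = x1 * x1 * x1 * X * X" "x3 ^ (2 * q + 1) = x3 * x3 * x3 * Z * Z"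
    by (simp_all only: power_add power3_eq_cube X_def Z_def)
  have pow2: "x1 ^ (m + q - 1) = X" "x1 ^ (m + q) = x1 * X" "x3 ^ (q - 1) = Z" "x3 ^ q = x3 * Z"
    by (simp_all add: q X_def Z_def)
  note pow = pow1 pow2
  have f2: "f2 q m = - (x1 * x1 * x1 * X * X) - X * x2 ^ 3 * Z + 3 * (x1 * X) * x2 * (x3 * Z)
    - x3 * x3 * x3 * Z * Z"
    unfolding f2_def pow ..
  show "x1 * f2 q m = - (g2 q m ^ 2) - x3 ^ (q - 1) * g1 q m * (g3 :: 'k poly poly poly)"
    unfolding f2 g1 g2 g3_def pow by (simp add: algebra_simps power2_eq_square power3_eq_cube)
  show "x2 ^ 2 * f2 q m = - (x1 * g1 q m ^ 2) + (g3 :: 'k poly poly poly) *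
       (2 * x3 ^ q * g1 q m + x3 ^ (2 * q + 1) - x1 ^ (m + q - 1) * x2 ^ 3 * x3 ^ (q - 1))"
    unfolding f2 g1 g2 g3_def pow by (simp add: algebra_simps power2_eq_square power3_eq_cube)
  show "x1 * g1 q m = x2 * g2 q m + x3 ^ q * (g3 :: 'k poly poly poly)"
    unfolding f2 g1 g2 g3_def pow by (simp add: algebra_simps power2_eq_square power3_eq_cube)
qed

text \<open>A lift of the monomial \<open>x2^(s mod 2) x3^(s div 2)\<close> with
  \<open>s = b (2 q + 1) + r\<close>. The signs compensate for \<open>g1\<close>, \<open>g2\<close>
  and \<open>f2\<close> reducing to negatives of monomials.\<close>

definition lift :: "nat \<Rightarrow> nat \<Rightarrow> nat \<Rightarrow> nat \<Rightarrow> 'k::field poly poly poly" where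
  "lift q m b r =
     (if even b then x2 ^ (r mod 2) else if odd r then - g1 q m else - g2 q m) *
     x3 ^ (r div 2) * (- f2 q m) ^ (b div 2)"

lemma dvd_diff_power: "d dvd a - b \<Longrightarrow> d dvd a ^ n - (b :: 'a::comm_ring_1) ^ n"
proof (induction n)
  case (Suc n)
  have "a ^ Suc n - b ^ Suc n = a * (a ^ n - b ^ n) + b ^ n * (a - b)"
    by (simp add: algebra_simps)
  with Suc show ?case by (metis dvd_add dvd_mult)
qed simp

text \<open>Modulo \<open>g3\<close>, each \<open>- f2\<close> turns two factors \<open>x2\<close>
  into \<open>x1 * g1 ^ 2\<close>. For odd \<open>b\<close> the remaining \<open>x2\<close> either
  converts \<open>g2\<close> into \<open>g1\<close> at the cost of one \<open>x1\<close>, or stays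
  when the factor is \<open>g1\<close> already.\<close>

lemma lift_initial_form:
  assumes "q \<ge> 1" "m \<ge> 1"
  shows "g3 dvd x2 ^ b * lift q m b r -
    (- 1) ^ b * g1 q m ^ b * (x1 ^ (b div 2 + (if odd b \<and> even r then 1 else 0)) *
      x2 ^ (r mod 2) * x3 ^ (r div 2) :: 'k::field poly poly poly)"
proof -
  define c where "c = b div 2"
  let ?F = "(- f2 q m) ^ c :: 'k poly poly poly"
  have "x2 ^ 2 * (- f2 q m) - x1 * g1 q m ^ 2 = g3 *
      - (2 * x3 ^ q * g1 q m + x3 ^ (2 * q + 1) - x1 ^ (m + q - 1) * x2 ^ 3 * x3 ^ (q - 1) :: 'k poly poly poly)"
    using f2_eq(2)[OF assms, where 'k = 'k] by (simp add: algebra_simps)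
  then have "g3 dvd x2 ^ 2 * (- f2 q m) - x1 * (g1 q m :: 'k poly poly poly) ^ 2" by (rule dvdI)
  then have "g3 dvd (x2 ^ 2 * (- f2 q m)) ^ c - (x1 * (g1 q m :: 'k poly poly poly) ^ 2) ^ c"
    by (rule dvd_diff_power)
  then have F: "g3 dvd x2 ^ (2 * c) * ?F - x1 ^ c * g1 q m ^ (2 * c)"
    by (simp only: power_mult_distrib power_mult)
  have g: "g3 dvd x2 * g2 q m - x1 * (g1 q m :: 'k poly poly poly)"
    using f2_eq(3)[OF assms, where 'k = 'k] by (intro dvdI[of _ _ "- (x3 ^ q)"]) (simp add: algebra_simps)
  show ?thesis
  proof (cases "even b")
    case True
    then have b: "b = 2 * c" by (auto simp: c_def)
    have "x2 ^ b * lift q m b r - (- 1) ^ b * g1 q m ^ b * (x1 ^ (b div 2 + (if odd b \<and> even r then 1 else 0)) *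
        x2 ^ (r mod 2) * x3 ^ (r div 2)) =
      (x2 ^ (2 * c) * ?F - x1 ^ c * g1 q m ^ (2 * c)) * (x2 ^ (r mod 2) * x3 ^ (r div 2))"
      by (simp add: lift_def b algebra_simps)
    then show ?thesis using F by (simp only: dvd_mult2)
  next
    case False
    then have b: "b = Suc (2 * c)" by (auto simp: c_def elim: oddE)
    show ?thesis
    proof (cases "even r")
      case True
      have "x2 ^ b * lift q m b r - (- 1) ^ b * g1 q m ^ b * (x1 ^ (b div 2 + (if odd b \<and> even r then 1 else 0)) *
          x2 ^ (r mod 2) * x3 ^ (r div 2)) =
        - (x2 ^ (2 * c) * ?F - x1 ^ c * g1 q m ^ (2 * c)) * (x2 * g2 q m * x3 ^ (r div 2))
        - (x2 * g2 q m - x1 * g1 q m) * (x1 ^ c * g1 q m ^ (2 * c) * x3 ^ (r div 2))"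
        using True by (simp add: lift_def b algebra_simps)
      then show ?thesis using F g by (simp only: dvd_mult2 dvd_diff dvd_minus_iff)
    next
      case odd: False
      then have "r mod 2 = 1" by presburger
      then have "x2 ^ b * lift q m b r - (- 1) ^ b * g1 q m ^ b * (x1 ^ (b div 2 + (if odd b \<and> even r then 1 else 0)) *
          x2 ^ (r mod 2) * x3 ^ (r div 2)) =
        - (x2 ^ (2 * c) * ?F - x1 ^ c * g1 q m ^ (2 * c)) * (x2 * g1 q m * x3 ^ (r div 2))"
        using odd by (simp add: lift_def b algebra_simps)
      then show ?thesis using F by (simp only: dvd_mult2 dvd_diff dvd_minus_iff)
    qed
  qed
qed

section \<open>Reduction modulo \<open>x1\<close>\<close>

lemma poly_mod_x1_generators:
  assumes "q \<ge> 1" "m \<ge> 1"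
  shows "poly_mod_x1 (g1 q m) = - (y3 ^ (q + 1) :: 'k::field poly poly)"
    "poly_mod_x1 (g2 q m) = - (y2 * y3 ^ q :: 'k poly poly)"
    "poly_mod_x1 g3 = (y2 ^ 2 :: 'k poly poly)"
    "poly_mod_x1 (f2 q m) = - (y3 ^ (2 * q + 1) :: 'k poly poly)"
  \<comment> \<open>Here \<open>m + q - 1\<close> is positive, so every term of \<open>f2\<close>
    except the last contains \<open>x1\<close>.\<close>
  unfolding g1_def g2_def g3_def f2_def poly_mod_x1_hom using assms by (simp_all add: zero_power)

text \<open>The cases in \<open>lift\<close> follow the parity of
  \<open>b * (2 * q + 1) + r\<close>. Each \<open>f2\<close> adds \<open>2 * q + 1\<close> to the
  exponent of \<open>y3\<close>, which is an increase of \<open>b\<close> by two.\<close>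

lemma poly_mod_x1_lift:
  assumes "q \<ge> 1" "m \<ge> 1"
  shows "poly_mod_x1 (lift q m b r) =
    y2 ^ ((b * (2 * q + 1) + r) mod 2) * y3 ^ ((b * (2 * q + 1) + r) div 2)"
proof -
  define c where "c = b div 2"
  have F: "poly_mod_x1 ((- f2 q m) ^ c) = y3 ^ (c * (2 * q + 1))"
    by (simp only: poly_mod_x1_hom poly_mod_x1_generators[OF assms] minus_minus mult.commute[of c]
        flip: power_mult)
  show ?thesis
  proof (cases "even b")
    case True
    then have b: "b = 2 * c" by (auto simp: c_def)
    have "b * (2 * q + 1) + r = r + 2 * (c * (2 * q + 1))" by (simp add: b)
    then have "(b * (2 * q + 1) + r) mod 2 = r mod 2"
      "(b * (2 * q + 1) + r) div 2 = r div 2 + c * (2 * q + 1)"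
      by (simp_all only: mod_mult_self2)
    with True show ?thesis
      by (simp add: lift_def poly_mod_x1_hom F[unfolded poly_mod_x1_hom] power_add flip: c_def)
  next
    case False
    then have b: "b = Suc (2 * c)" by (auto simp: c_def elim: oddE)
    have s: "b * (2 * q + 1) + r = 2 * (c * (2 * q + 1)) + (2 * q + 1 + r)"
      by (simp add: b algebra_simps)
    show ?thesis
    proof (cases "even r")
      case True
      then have "b * (2 * q + 1) + r = 1 + 2 * (q + r div 2 + c * (2 * q + 1))"
        unfolding s by (auto elim!: evenE)
      then have "(b * (2 * q + 1) + r) mod 2 = 1"
        "(b * (2 * q + 1) + r) div 2 = q + r div 2 + c * (2 * q + 1)"
        by (simp_all only: mod_mult_self2) simp_all
      with True False show ?thesis
        unfolding lift_def poly_mod_x1.mult F[unfolded c_def]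
        by (simp add: poly_mod_x1_hom poly_mod_x1_generators[OF assms] power_add flip: c_def)
    next
      case odd: False
      then have "(b * (2 * q + 1) + r) mod 2 = 0"
        "(b * (2 * q + 1) + r) div 2 = Suc q + r div 2 + c * (2 * q + 1)"
        unfolding s by (auto elim!: oddE)
      with odd False show ?thesis
        unfolding lift_def poly_mod_x1.mult F[unfolded c_def]
        by (simp add: poly_mod_x1_hom poly_mod_x1_generators[OF assms] power_add flip: c_def)
    qed
  qed
qed

text \<open>\<open>g3\<close>, \<open>g1\<close> and \<open>g2\<close> count one and
  \<open>f2\<close> counts two, matching \<open>b = b mod 2 + 2 * (b div 2)\<close>.\<close>

lemma lift_in_cal_I: "g3 ^ a * lift q m b r \<in> cal_I q m (a + b)"
proof -
  let ?A = "idl {g1 q m, g2 q m, g3}" and ?B = "idl {f2 q m}"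
  let ?h = "if even b then x2 ^ (r mod 2) else if odd r then - g1 q m else - g2 q m"
  have mem: "g1 q m \<in> ?A" "g2 q m \<in> ?A" "g3 \<in> ?A" "f2 q m \<in> ?B" by (auto intro: idl_incl)
  have h: "?h * x3 ^ (r div 2) \<in> ideal_pow ?A (b mod 2)"
  proof (cases "even b")
    case False
    then have A: "ideal_pow ?A (b mod 2) = ?A"
      using ideal_pow_1[OF is_ideal_idl] by (simp add: odd_iff_mod_2_eq_one)
    show ?thesis
      unfolding A using False by (simp add: is_idealD[OF is_ideal_idl] mem)
  qed (simp add: ideal_pow_0)
  have "g3 ^ a * (?h * x3 ^ (r div 2)) \<in> ideal_pow ?A (a + b mod 2)"
    by (intro ideal_pow_add is_ideal_idl power_in_ideal_pow h mem)
  moreover have "(- f2 q m) ^ (b div 2) \<in> ideal_pow ?B (b div 2)"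
    by (intro power_in_ideal_pow is_idealD mem is_ideal_idl)
  moreover have "a + b mod 2 + 2 * (b div 2) = a + b" by simp
  ultimately have "g3 ^ a * (?h * x3 ^ (r div 2)) * (- f2 q m) ^ (b div 2) \<in> cal_I q m (a + b)"
    unfolding cal_I_def by (intro weighted_sum_incl[OF is_ideal_idl is_ideal_idl]) auto
  then show ?thesis by (simp only: lift_def mult.assoc)
qed

text \<open>
  Every monomial is one of those with index \<open>(a, b, r)\<close>, \<open>a + b < n\<close>, or a multiple of one of
  those with \<open>a + b = n\<close> and \<open>r < 2\<close>.
\<close>

definition idx :: "nat \<Rightarrow> nat \<Rightarrow> (nat \<times> nat \<times> nat) set" where
  "idx q n = {(a, b, r). a + b < n \<and> r < 2 * q + 1} \<union> {(a, b, r). a + b = n \<and> r < 2}"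

definition elt :: "nat \<Rightarrow> nat \<Rightarrow> nat \<times> nat \<times> nat \<Rightarrow> 'k::field poly poly poly" where
  "elt q m = (\<lambda>(a, b, r). g3 ^ a * lift q m b r)"

lemma finite_idx: "finite (idx q n)"
  by (rule finite_subset[of _ "{..n} \<times> {..n} \<times> {..2 * q + 1}"]) (auto simp: idx_def)

text \<open>Each monomial is assigned to one index whose monomial divides it. Below level
  \<open>n\<close> the assignment is exact, so the cofactor is a constant.\<close>

lemma power_series_decomposition:
  assumes qm: "q \<ge> 1" "m \<ge> 1"
  shows "\<exists>w. (\<forall>u\<in>idx q n. w u \<in> (if fst u + fst (snd u) < n then range (\<lambda>c. fps_const (fps_const c)) else UNIV)) \<and>
    (S :: 'k::field fps fps) = (\<Sum>u\<in>idx q n. w u * emb2 (poly_mod_x1 (elt q m u)))"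
proof -
  let ?N = "2 * q + 1"
  define J where "J = (\<lambda>(a, b, r). 2 * a + (b * ?N + r) mod 2)"
  define E where "E = (\<lambda>(a :: nat, b, r). (b * ?N + r) div 2)"
  \<comment> \<open>\<open>y2 ^ j * y3 ^ e\<close> has index \<open>(a, s div ?N, s mod ?N)\<close>.
    From level \<open>n\<close> on, a divisor at level \<open>n\<close> is chosen instead; in the
    last branch the third entry is the parity correction that keeps the exponent of
    \<open>y2\<close> equal to \<open>j\<close>.\<close>
  define p where "p j e = (let a = j div 2; s = 2 * e + j mod 2 in
     if a \<ge> n then (n, 0, 0) else if a + s div ?N < n then (a, s div ?N, s mod ?N)
     else (a, n - a, (j + (n - a)) mod 2))" for j e
  have elt: "emb2 (poly_mod_x1 (elt q m u)) = fps_X ^ J u * (fps_const (fps_X ^ E u) :: 'k fps fps)" for u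
    by (cases u) (simp add: elt_def J_def E_def poly_mod_x1.mult poly_mod_x1_lift[OF qm] poly_mod_x1_power
      poly_mod_x1_generators[OF qm] emb2_mult emb2_power emb2_variables fps_const_power power_add power_mult mult.assoc)
  have p_idx: "p j e \<in> idx q n" for j e
    by (auto simp: p_def idx_def Let_def)
  have p_le: "J (p j e) \<le> j \<and> E (p j e) \<le> e" for j e
  proof -
    define a s where "a = j div 2" and "s = 2 * e + j mod 2"
    have js: "j = 2 * a + s mod 2" "e = s div 2" by (simp_all add: a_def s_def)
    consider "a \<ge> n" | "a < n" "a + s div ?N < n" | "a < n" "a + s div ?N \<ge> n" by linarith
    then show ?thesis
    proof cases
      case 1
      then show ?thesis by (auto simp: p_def J_def E_def a_def)
    next
      case 2
      then have "p j e = (a, s div ?N, s mod ?N)"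
        by (simp add: p_def Let_def flip: a_def s_def)
      moreover have "s div ?N * ?N + s mod ?N = s" by (rule div_mult_mod_eq)
      ultimately show ?thesis by (simp only: J_def E_def prod.case js order_refl simp_thms)
    next
      case 3
      let ?r = "(j + (n - a)) mod 2"
      have p: "p j e = (a, n - a, ?r)"
        using 3 by (simp add: p_def Let_def flip: a_def s_def)
      have "((n - a) * ?N + ?r) mod 2 = s mod 2"
      proof -
        have "(2 * t + d + (j + d) mod 2) mod 2 = j mod 2" for t d j :: nat
        proof -
          have "2 * t + d + (j + d) = j + 2 * (t + d)" by simp
          then show ?thesis by (metis mod_add_right_eq mod_mult_self2)
        qed
        from this[of "(n - a) * q" "n - a" j] show ?thesis by (simp add: js(1) algebra_simps)
      qed
      moreover have "(n - a) * ?N \<le> s"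
        using 3 by (metis le_diff_conv add.commute div_times_less_eq_dividend mult_le_mono1 order_trans)
      moreover have "?r < 2" by simp
      \<comment> \<open>Rounding \<open>(n - a) * ?N\<close> up to the parity of \<open>s\<close>
        cannot overshoot \<open>s\<close>.\<close>
      moreover have "x + r \<le> y" if "(x + r) mod 2 = y mod 2" "x \<le> y" "r < 2" for x r y :: nat
      proof -
        have "(y + 1) mod 2 \<noteq> y mod 2" for y :: nat by presburger
        moreover have "r = 0 \<or> r = 1" using that by linarith
        ultimately have "x \<noteq> y \<or> r = 0" using that(1) by metis
        with that show ?thesis by linarith
      qed
      ultimately have "(n - a) * ?N + ?r \<le> s" by blast
      then show ?thesis
        unfolding p using \<open>((n - a) * ?N + ?r) mod 2 = s mod 2\<close>
        by (simp add: J_def E_def js(1) js(2) div_le_mono)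
    qed
  qed
  \<comment> \<open>Only the middle branch of \<open>p\<close> yields a level below
    \<open>n\<close>; the other two yield exactly \<open>n\<close>.\<close>
  have p_std: "J (p j e) = j \<and> E (p j e) = e" if "fst (p j e) + fst (snd (p j e)) < n" for j e
  proof -
    define a s where "a = j div 2" and "s = 2 * e + j mod 2"
    have js: "j = 2 * a + s mod 2" "e = s div 2" by (simp_all add: a_def s_def)
    have "p j e = (a, s div ?N, s mod ?N)"
      using that by (auto simp: p_def Let_def simp flip: a_def s_def split: if_splits)
    moreover have "s div ?N * ?N + s mod ?N = s" by (rule div_mult_mod_eq)
    ultimately show ?thesis by (simp only: J_def E_def prod.case js order_refl simp_thms)
  qed
  \<comment> \<open>\<open>w u\<close> collects the coefficients of all monomials assigned to
    \<open>u\<close>, divided by the monomial of \<open>u\<close>.\<close>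
  define w where "w u = Abs_fps (\<lambda>i. Abs_fps (\<lambda>k. if p (J u + i) (E u + k) = u then S $ (J u + i) $ (E u + k) else 0))"
    for u
  have coeff: "(w u * emb2 (poly_mod_x1 (elt q m u))) $ j $ e = (if p j e = u then S $ j $ e else 0)" for u j e
  proof -
    have *: "w u * emb2 (poly_mod_x1 (elt q m u)) = w u * fps_const (fps_X ^ E u) * fps_X ^ J u"
      by (simp add: elt ac_simps)
    have "(w u * emb2 (poly_mod_x1 (elt q m u))) $ j $ e =
        (if J u \<le> j \<and> E u \<le> e then w u $ (j - J u) $ (e - E u) else 0)"
      unfolding * by (simp add: fps_X_power_mult_right_nth)
    also have "\<dots> = (if p j e = u then S $ j $ e else 0)"
      using p_le[of j e] by (auto simp: w_def)
    finally show ?thesis .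
  qed
  have "S = (\<Sum>u\<in>idx q n. w u * emb2 (poly_mod_x1 (elt q m u)))"
    by (intro fps_ext) (simp add: fps_sum_nth coeff finite_idx p_idx)
  moreover have "w u \<in> range (\<lambda>c. fps_const (fps_const c))" if "fst u + fst (snd u) < n" for u
  proof -
    have "p (J u + i) (E u + k) = u \<Longrightarrow> i = 0 \<and> k = 0" for i k
      using p_std[of "J u + i" "E u + k"] that by auto
    then have "w u $ i $ k = 0" if "i \<noteq> 0 \<or> k \<noteq> 0" for i k
      using that by (fastforce simp: w_def)
    then have "w u = fps_const (fps_const (w u $ 0 $ 0))"
      by (intro fps_ext) auto
    then show ?thesis by blast
  qed
  ultimately show ?thesis by (intro exI[of _ w]) auto
qed

section \<open>Symbolic powers of the monomial curve\<close>

text \<open>Iterates \<open>power_series_decomposition\<close> along powers of \<open>x1\<close>.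
  Below level \<open>n\<close> the coefficients of \<open>W u\<close> are constants, that is,
  \<open>W u\<close> lies in \<open>k[[x1]]\<close>.\<close>

lemma division_by_elt:
  fixes F :: "'k::field fps fps fps"
  assumes qm: "q \<ge> 1" "m \<ge> 1"
  obtains W where
    "\<And>a b r k. a + b < n \<Longrightarrow> r < 2 * q + 1 \<Longrightarrow> W (a, b, r) $ k \<in> range (\<lambda>c. fps_const (fps_const c))"
    "F = (\<Sum>u\<in>idx q n. W u * emb3 (elt q m u))"
proof -
  let ?C = "\<lambda>u :: nat \<times> nat \<times> nat. if fst u + fst (snd u) < n then range (\<lambda>c. fps_const (fps_const c)) else (UNIV :: 'k fps fps set)"
  obtain W where W: "\<And>u k. u \<in> idx q n \<Longrightarrow> W u $ k \<in> ?C u" "F = (\<Sum>u\<in>idx q n. W u * emb3 (elt q m u))"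
  proof (rule fps_division[of UNIV "idx q n" ?C "\<lambda>u. emb3 (elt q m u)" F])
    fix F :: "'k fps fps fps"
    obtain w where w: "\<forall>u\<in>idx q n. w u \<in> ?C u"
      "F $ 0 = (\<Sum>u\<in>idx q n. w u * emb2 (poly_mod_x1 (elt q m u)))"
      using power_series_decomposition[OF qm, of n "F $ 0"] by blast
    have "(F - (\<Sum>u\<in>idx q n. fps_const (w u) * emb3 (elt q m u))) $ 0 = 0"
      using w(2) by (simp add: fps_sum_nth poly_mod_x1_def)
    then obtain G where "F - (\<Sum>u\<in>idx q n. fps_const (w u) * emb3 (elt q m u)) = fps_X * G"
      using fps_X_dvd_iff by blast
    then have "F = (\<Sum>u\<in>idx q n. fps_const (w u) * emb3 (elt q m u)) + fps_X * G"
      by (simp add: algebra_simps)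
    with w(1) show "\<exists>w. (\<forall>u\<in>idx q n. w u \<in> ?C u) \<and>
        (\<exists>G\<in>UNIV. F = (\<Sum>u\<in>idx q n. fps_const (w u) * emb3 (elt q m u)) + fps_X * G)"
      by blast
  qed auto
  have "W (a, b, r) $ k \<in> range (\<lambda>c. fps_const (fps_const c))" if "a + b < n" "r < 2 * q + 1" for a b r k
    using W(1)[of "(a, b, r)" k] that by (simp add: idx_def)
  with W(2) that show ?thesis by blast
qed

text \<open>Modulo \<open>x1\<close> the pair becomes \<open>y2 ^ 2\<close> and
  \<open>- (y3 ^ (q + 1))\<close>, which is regular; \<open>x1\<close>-adic division by
  \<open>g3\<close> lifts this.\<close>

lemma g3_g1_regular:
  fixes h :: "'k::field fps fps fps"
  assumes qm: "q \<ge> 1" "m \<ge> 1" and h: "emb3 g3 dvd emb3 (g1 q m) * h"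
  shows "emb3 g3 dvd h"
proof -
  let ?G3 = "emb3 (g3 :: 'k poly poly poly)" and ?G1 = "emb3 (g1 q m :: 'k poly poly poly)"
  have G3: "?G3 $ 0 = fps_X ^ 2"
    using poly_mod_x1_generators(3)[OF qm, where 'k = 'k]
    by (simp add: poly_mod_x1_def emb2_power emb2_variables)
  have G1: "?G1 $ 0 = - fps_const (fps_X ^ (q + 1))"
    using poly_mod_x1_generators(1)[OF qm, where 'k = 'k]
    by (simp add: poly_mod_x1_def emb2_power emb2_variables emb2.uminus emb2.mult fps_const_power
        del: fps_const_neg fps_const_mult flip: power_Suc)
  \<comment> \<open>Division by the single element \<open>?G3\<close>. The set of admissible series
    is the divisibility hypothesis, which each remainder must inherit.\<close>
  obtain W where "h = (\<Sum>u\<in>{()}. W u * ?G3)"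
  proof (rule fps_division[of "{h. ?G3 dvd ?G1 * h}" "{()}" "\<lambda>_. UNIV" "\<lambda>_. ?G3" h])
    fix F assume "F \<in> {h. ?G3 dvd ?G1 * h}"
    then obtain v where v: "?G1 * F = ?G3 * v" by blast
    have F0: "F $ 0 $ j = 0" if "j < 2" for j
    proof -
      have "(?G1 * F) $ 0 $ j = (?G3 * v) $ 0 $ j" using v by simp
      then have "fps_X ^ (q + 1) * F $ 0 $ j = 0"
        using that by (simp add: G1 G3 fps_X_power_mult_nth del: power_Suc emb3_nth)
      then show ?thesis by simp
    qed
    define w where "w = fps_shift 2 (F $ 0)"
    have "Suc (Suc (j - 2)) = j" if "\<not> j < 2" for j using that by simp
    then have w: "F $ 0 = fps_X ^ 2 * w"
      by (intro fps_ext) (auto simp: w_def fps_X_power_mult_nth F0)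
    have "(F - fps_const w * ?G3) $ 0 = 0" by (simp add: w G3 del: emb3_nth)
    then obtain G where G: "F - fps_const w * ?G3 = fps_X * G"
      using fps_X_dvd_iff by blast
    have "fps_X * (?G1 * G) = ?G1 * (F - fps_const w * ?G3)"
      by (simp only: G mult.left_commute)
    also have "\<dots> = ?G1 * F - ?G3 * (?G1 * fps_const w)" by (simp add: algebra_simps)
    \<comment> \<open>As \<open>?G3 $ 0\<close> is nonzero, \<open>fps_X\<close> must divide the
      other factor, so it cancels and leaves the hypothesis for \<open>G\<close>.\<close>
    finally have eq: "fps_X * (?G1 * G) = ?G3 * (v - ?G1 * fps_const w)"
      by (simp only: v right_diff_distrib)
    then have "(?G3 * (v - ?G1 * fps_const w)) $ 0 = 0"
      by (metis fps_X_dvd_iff dvd_triv_left)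
    then have "(v - ?G1 * fps_const w) $ 0 = 0" by (simp add: G3 del: emb3_nth)
    then obtain v' where "v - ?G1 * fps_const w = fps_X * v'"
      using fps_X_dvd_iff by blast
    then have "fps_X * (?G1 * G) = fps_X * (?G3 * v')" using eq by (simp only: mult.left_commute)
    then have "?G1 * G = ?G3 * v'" by simp
    moreover have "F = fps_const w * ?G3 + fps_X * G" using G by (simp add: algebra_simps)
    ultimately show "\<exists>w. (\<forall>j\<in>{()}. w j \<in> UNIV) \<and>
        (\<exists>G\<in>{h. ?G3 dvd ?G1 * h}. F = (\<Sum>j\<in>{()}. fps_const (w j) * ?G3) + fps_X * G)"
      by (intro exI[of _ "\<lambda>_. w"]) auto
  qed (use h in auto)
  then show ?thesis by simp
qed

section \<open>The curve prime, its generators and the second symbolic power\<close>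

context
  fixes q m :: nat
  assumes qm: "q \<ge> 1" "m \<ge> 1" and coprime: "coprime (2 * q + 1) m"
begin

abbreviation symb :: "nat \<Rightarrow> 'k::field fps fps fps set"
  where "symb \<equiv> symbolic_power (curve_prime q m)"

lemmas prime = curve_prime_primeideal[of q m]

lemma variables_notin_curve_prime:
  "emb3 (x1 :: 'k::field poly poly poly) \<notin> curve_prime q m" "emb3 (x2 :: 'k poly poly poly) \<notin> curve_prime q m"
  by (simp_all add: curve_prime_eq phi_variables)

lemma phi_1: "phi q m 1 = 1"
  using phi_const[of q m 1] by simp

lemma phi_power: "phi q m (F ^ n) = phi q m F ^ n"
  by (induction n) (simp_all add: phi_1 phi_mult)

text \<open>The two monomials of each binomial have the same weight.\<close>

lemma generators_in_curve_prime:
  fixes P :: "'k::field fps fps fps set"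
  defines "P \<equiv> curve_prime q m"
  shows "emb3 (g1 q m) \<in> P" "emb3 (g2 q m) \<in> P" "emb3 g3 \<in> P"
proof -
  have "weight q m 1 * (m + q) + weight q m 2 = weight q m 3 * (q + 1)"
    "weight q m 1 * (m + q + 1) = weight q m 2 + weight q m 3 * q"
    "weight q m 2 * 2 = weight q m 1 + weight q m 3"
    by (simp_all add: weight_def algebra_simps)
  then show "emb3 (g1 q m) \<in> P" "emb3 (g2 q m) \<in> P" "emb3 g3 \<in> P"
    unfolding P_def curve_prime_eq g1_def g2_def g3_def mem_Collect_eq emb3_hom phi.diff phi_mult
      phi_power phi_variables by (simp_all only: diff_self flip: power_mult power_add)
qed

text \<open>By \<open>f2_eq\<close> the multiple \<open>x1 * f2\<close> is a combination of products
  of two elements of the prime, and \<open>x1\<close> lies outside it.\<close>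

lemma f2_in_symbolic_square: "emb3 (f2 q m :: 'k::field poly poly poly) \<in> symb 2"
proof (rule symbolic_power_saturated[OF prime variables_notin_curve_prime(1)])
  note id = is_ideal_symbolic_power[OF prime, of 2]
  have mult: "x * y \<in> symb 2" if "x \<in> curve_prime q m" "y \<in> curve_prime q m" for x y :: "'k fps fps fps"
    using symbolic_power_mult[OF prime, of x "Suc 0" y "Suc 0"] that
    by (simp add: symbolic_power_1[OF prime] numeral_2_eq_2)
  have "- (emb3 (g2 q m) * emb3 (g2 q m)) -
      emb3 (x3 ^ (q - 1)) * (emb3 (g1 q m) * emb3 (g3 :: 'k poly poly poly)) \<in> symb 2"
    by (intro is_idealD(6)[OF id] is_idealD(5)[OF id] is_idealD(3)[OF id, of "_ * emb3 g3"] mult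
        generators_in_curve_prime)
  then have "emb3 (x1 * f2 q m :: 'k poly poly poly) \<in> symb 2"
    by (subst f2_eq(1)[OF qm]) (simp add: emb3_hom power2_eq_square mult.assoc)
  then show "emb3 x1 * emb3 (f2 q m :: 'k poly poly poly) \<in> symb 2" by (simp add: emb3.mult)
qed

lemma emb3_cal_I_subset:
  "emb3 ` cal_I q m n \<subseteq> weighted_sum (curve_prime q m) (symb 2) n"
  unfolding cal_I_def
proof (rule emb3.image_weighted_sum_subset)
  note id = prime_is_ideal[OF prime] is_ideal_symbolic_power[OF prime, of 2]
  show "is_ideal (curve_prime q m)" "is_ideal (symb 2)" by (rule id)+
  have "idl {g1 q m, g2 q m, g3} \<subseteq> emb3 -` curve_prime q m"
    by (intro idl_least emb3.vimage_ideal id) (use generators_in_curve_prime in auto)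
  then show "emb3 ` idl {g1 q m, g2 q m, g3} \<subseteq> curve_prime q m" by blast
  have "idl {f2 q m} \<subseteq> emb3 -` symb 2"
    by (intro idl_least emb3.vimage_ideal id) (use f2_in_symbolic_square in auto)
  then show "emb3 ` idl {f2 q m} \<subseteq> symb 2" by blast
qed (rule is_ideal_idl)+

lemma weighted_sum_subset_symb: "weighted_sum (curve_prime q m) (symb 2) n \<subseteq> symb n"
  by (intro weighted_sum_subset_symbolic_power prime prime_is_ideal is_ideal_symbolic_power order_refl)

lemma elt_in_symb: "emb3 (elt q m (a, b, r)) \<in> symb (a + b)"
  using lift_in_cal_I[of a q m b r] emb3_cal_I_subset[of "a + b"] weighted_sum_subset_symb[of "a + b"]
  by (auto simp: elt_def)

text \<open>Division at level one: the residue monomials cannot contribute to an element of the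
  prime, so \<open>F\<close> is a combination of \<open>g1\<close>, \<open>g2\<close>,
  \<open>g3\<close>, and \<open>x2 * g2\<close> lies in the ideal of \<open>g3\<close> and
  \<open>g1\<close>. This supplies the denominator \<open>c = x2\<close>.\<close>

lemma x2_curve_prime_subset:
  fixes F :: "'k::field fps fps fps"
  assumes F: "F \<in> curve_prime q m"
  shows "emb3 x2 * F \<in> idl {emb3 g3, emb3 (g1 q m)}"
proof -
  let ?I = "idl {emb3 g3, emb3 (g1 q m)} :: 'k fps fps fps set"
  note id = is_idealD[OF is_ideal_idl] and P = is_idealD[OF prime_is_ideal[OF prime]]
  obtain W where W: "\<And>a b r k. a + b < 1 \<Longrightarrow> r < 2 * q + 1 \<Longrightarrow> W (a, b, r) $ k \<in> range (\<lambda>c. fps_const (fps_const c))"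
    "F = (\<Sum>u\<in>idx q 1. W u * emb3 (elt q m u))"
    by (rule division_by_elt[OF qm, of 1 F]) (use that in blast)
  let ?gen = "{(a :: nat, b :: nat, r). a + b = 1 \<and> r < (2 :: nat)}"
  let ?std = "{(a :: nat, b :: nat, r). a + b < 1 \<and> r < 2 * q + 1}"
  have fin: "finite ?gen" "finite ?std"
    by (rule finite_subset[OF _ finite_idx[of q 1]], auto simp: idx_def)+
  have split: "F = (\<Sum>u\<in>?std. W u * emb3 (elt q m u)) + (\<Sum>u\<in>?gen. W u * emb3 (elt q m u))"
    unfolding W(2) idx_def by (rule sum.union_disjoint[OF fin(2,1)]) auto
  have gen: "(\<Sum>u\<in>?gen. W u * emb3 (elt q m u)) \<in> curve_prime q m"
  proof (intro is_ideal_sum[OF prime_is_ideal[OF prime]] P(3))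
    fix u assume "u \<in> ?gen"
    then obtain a b r where "u = (a, b, r)" "a + b = Suc 0" by auto
    then show "emb3 (elt q m u) \<in> curve_prime q m"
      using elt_in_symb[of a b r] by (simp add: symbolic_power_1[OF prime])
  qed
  have std: "(\<Sum>u\<in>?std. W u * emb3 (elt q m u)) \<in> curve_prime q m"
    using P(6)[OF F gen] by (subst (asm) (1) split) simp
  have "?std = (\<lambda>r. (0, 0, r)) ` {..<2 * q + 1}" by auto
  then have "(\<Sum>u\<in>?std. W u * emb3 (elt q m u)) = (\<Sum>r<2 * q + 1. W (0, 0, r) * emb3 (elt q m (0, 0, r)))"
    by (simp add: sum.reindex inj_on_def)
  also have "\<dots> = (\<Sum>r<2 * q + 1. W (0, 0, r) * emb3 (x1 ^ 0 * x2 ^ (r mod 2) * x3 ^ (r div 2)))"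
    by (simp add: elt_def lift_def)
  finally have "W (0, 0, r) = 0" if "r < 2 * q + 1" for r
    using residue_monomials_independent[OF coprime, of "\<lambda>r. W (0, 0, r)" "\<lambda>_. 0" r] std W(1) that by simp
  then have "(\<Sum>u\<in>?std. W u * emb3 (elt q m u)) = 0" by (intro sum.neutral) auto
  with split have "emb3 x2 * F = (\<Sum>u\<in>?gen. W u * emb3 (x2 * elt q m u))"
    by (simp add: sum_distrib_left emb3.mult mult.left_commute)
  moreover have "x2 * elt q m u \<in> idl {g3, g1 q m :: 'k poly poly poly}" if "u \<in> ?gen" for u
  proof -
    have mem: "g3 \<in> idl {g3, g1 q m :: 'k poly poly poly}" "g1 q m \<in> idl {g3, g1 q m :: 'k poly poly poly}"
      by (auto intro: idl_incl)
    have "x2 * g2 q m = x1 * g1 q m - x3 ^ q * (g3 :: 'k poly poly poly)"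
      using f2_eq(3)[OF qm, where 'k = 'k] by (simp add: algebra_simps)
    then have g2: "x2 * g2 q m \<in> idl {g3, g1 q m :: 'k poly poly poly}"
      by (simp add: id mem)
    \<comment> \<open>These indices give \<open>- g2\<close>, \<open>- g1\<close>, \<open>g3\<close>
      and \<open>g3 * x2\<close>.\<close>
    from that have "u \<in> {(0, 1, 0), (0, 1, 1), (1, 0, 0), (1, 0, 1)}" by (auto simp: less_2_cases_iff add_is_1)
    then show ?thesis
      by (auto simp: elt_def lift_def id mem g2)
  qed
  then have "emb3 (x2 * elt q m u) \<in> ?I" if "u \<in> ?gen" for u
    using emb3.image_idl_subset[of "{g3, g1 q m :: 'k poly poly poly}"] that by auto
  ultimately show ?thesis
    by (auto intro!: is_ideal_sum is_ideal_idl id(3))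
qed

text \<open>Induction on the level \<open>i = a + b\<close>, then on the exponent \<open>a\<close>
  of \<open>g3\<close>. Lower levels and smaller \<open>a\<close> vanish by induction, higher levels
  lie in \<open>symb (Suc i)\<close>, and larger \<open>a\<close> give multiples of
  \<open>g3 ^ Suc a\<close>. One row \<open>(a, b, _)\<close> remains to be tested.\<close>

lemma standard_coefficients_vanish:
  fixes W :: "nat \<times> nat \<times> nat \<Rightarrow> 'k::field fps fps fps"
  defines "std n \<equiv> {(a, b, r). a + b < n \<and> r < 2 * q + 1}"
  assumes W: "\<And>a b r k. a + b < n \<Longrightarrow> r < 2 * q + 1 \<Longrightarrow> W (a, b, r) $ k \<in> range (\<lambda>c. fps_const (fps_const c))"
    and F: "(\<Sum>u\<in>std n. W u * emb3 (elt q m u)) \<in> symb n"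
    and "i < n" "a \<le> i" "r < 2 * q + 1"
  shows "W (a, i - a, r) = 0"
  using \<open>i < n\<close> \<open>a \<le> i\<close> \<open>r < 2 * q + 1\<close>
proof (induction i arbitrary: a r rule: less_induct)
  case (less i)
  note level = less.IH and i = less.prems(1)
  show ?case using less.prems(2,3)
  proof (induction a arbitrary: r rule: less_induct)
    case (less a)
    let ?G3 = "emb3 g3 :: 'k fps fps fps" and ?G1 = "emb3 (g1 q m) :: 'k fps fps fps" and ?N = "2 * q + 1"
    define b where "b = i - a"
    have iab: "i = a + b" using less.prems by (simp add: b_def)
    have id: "is_ideal (symb (Suc i) :: 'k fps fps fps set)"
      by (rule is_ideal_symbolic_power[OF prime])
    note symb = is_idealD[OF id]
    let ?t = "\<lambda>u. W u * emb3 (elt q m u)"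
    let ?row = "(\<lambda>r. (a, b, r)) ` {..<?N}"
    have fin: "finite (std n)"
      by (rule finite_subset[OF _ finite_idx[of q n]]) (auto simp: std_def idx_def)
    have row: "?row \<subseteq> std n" using i iab by (auto simp: std_def)
    have "\<exists>z. ?t u - ?G3 ^ Suc a * z \<in> symb (Suc i)" if u: "u \<in> std n - ?row" for u
    proof -
      obtain a' b' r' where u': "u = (a', b', r')" "a' + b' < n" "r' < ?N" "\<not> (a' = a \<and> b' = b)"
        using u by (auto simp: std_def)
      have "W u = 0" if "a' + b' < i"
        using level[OF that, of a' r'] i u' by simp
      moreover have "W u = 0" if "a' + b' = i" "a' < a"
      proof -
        from that have "b' = i - a'" by simp
        then show ?thesis using less.IH[of a' r'] that less.prems u' by simp
      qed
      ultimately consider "W u = 0" | "a < a'" | "a' + b' \<ge> Suc i"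
        using u'(4) iab by linarith
      then show ?thesis
      proof cases
        case 1
        then show ?thesis using symb(1) by (intro exI[of _ 0]) simp
      next
        case 2
        then have "?G3 ^ a' = ?G3 ^ Suc a * ?G3 ^ (a' - Suc a)"
          by (metis Suc_leI le_add_diff_inverse power_add)
        then have "?t u - ?G3 ^ Suc a * (?G3 ^ (a' - Suc a) * (W u * emb3 (lift q m b' r'))) = 0"
          by (simp add: u' elt_def emb3_hom ac_simps)
        then show ?thesis using symb(1) by metis
      next
        case 3
        have "emb3 (elt q m u) \<in> symb (Suc i)"
          using elt_in_symb[of a' b' r'] symbolic_power_antimono[OF prime 3] by (auto simp: u')
        then show ?thesis using symb(3) by (intro exI[of _ 0]) simp
      qed
    qed
    then obtain Z where Z: "\<And>u. u \<in> std n - ?row \<Longrightarrow> ?t u - ?G3 ^ Suc a * Z u \<in> symb (Suc i)"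
      by metis
    define z where "z = (\<Sum>u\<in>std n - ?row. Z u)"
    define h where "h = (\<Sum>r<?N. W (a, b, r) * emb3 (lift q m b r))"
    have "(\<Sum>u\<in>std n. ?t u) = (\<Sum>u\<in>std n - ?row. ?t u) + (\<Sum>u\<in>?row. ?t u)"
      by (rule sum.subset_diff[OF row fin])
    also have "(\<Sum>u\<in>?row. ?t u) = ?G3 ^ a * h"
      by (simp add: h_def sum.reindex inj_on_def elt_def emb3_hom sum_distrib_left mult.left_commute
          del: sum.lessThan_Suc)
    also have "(\<Sum>u\<in>std n - ?row. ?t u) = (\<Sum>u\<in>std n - ?row. ?t u - ?G3 ^ Suc a * Z u) + ?G3 ^ Suc a * z"
      by (simp add: z_def sum_subtractf sum_distrib_left)
    finally have "?G3 ^ a * (h + ?G3 * z) =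
        (\<Sum>u\<in>std n. ?t u) - (\<Sum>u\<in>std n - ?row. ?t u - ?G3 ^ Suc a * Z u)"
      by (simp add: algebra_simps)
    also have "\<dots> \<in> symb (Suc i)"
    proof (rule symb(6))
      show "(\<Sum>u\<in>std n. ?t u) \<in> symb (Suc i)"
        using F symbolic_power_antimono[OF prime, of "Suc i" n] i by auto
      show "(\<Sum>u\<in>std n - ?row. ?t u - ?G3 ^ Suc a * Z u) \<in> symb (Suc i)"
        by (rule is_ideal_sum[OF is_ideal_symbolic_power[OF prime]]) (rule Z)
    qed
    finally have row_sum: "?G3 ^ a * (h + ?G3 * z) \<in> symb (a + Suc b)" by (simp add: iab)
    have "?G3 $ 0 \<noteq> 0"
      using poly_mod_x1_generators(3)[OF qm, where 'k = 'k]
      by (simp add: poly_mod_x1_def emb2_power emb2_variables)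
    then have nz: "?G3 \<noteq> 0" by (metis fps_zero_nth)
    note regular = prime generators_in_curve_prime(3,1)[where 'k = 'k] nz g3_g1_regular[OF qm]
      variables_notin_curve_prime(2) x2_curve_prime_subset
    \<comment> \<open>Cancelling \<open>?G3 ^ a\<close> lowers the symbolic order from
      \<open>a + Suc b\<close> to \<open>Suc b\<close>.\<close>
    have hz: "h + ?G3 * z \<in> symb (Suc b)"
      by (rule symbolic_power_cancel_power[OF regular row_sum])
    let ?mono = "\<lambda>r. emb3 (x1 ^ (b div 2 + (if odd b \<and> even r then 1 else 0)) *
      x2 ^ (r mod 2) * x3 ^ (r div 2)) :: 'k fps fps fps"
    define y where "y = (\<Sum>r<?N. W (a, b, r) * ?mono r)"
    have "\<exists>v. emb3 x2 ^ b * emb3 (lift q m b r) = (- 1) ^ b * ?G1 ^ b * ?mono r + ?G3 * v" for r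
    proof -
      from lift_initial_form[OF qm, of b r, where 'k = 'k] obtain v where
        "x2 ^ b * lift q m b r - (- 1) ^ b * g1 q m ^ b * (x1 ^ (b div 2 + (if odd b \<and> even r then 1 else 0)) *
          x2 ^ (r mod 2) * x3 ^ (r div 2) :: 'k poly poly poly) = g3 * v" ..
      then have "x2 ^ b * lift q m b r = (- 1) ^ b * g1 q m ^ b * (x1 ^ (b div 2 + (if odd b \<and> even r then 1 else 0)) *
          x2 ^ (r mod 2) * x3 ^ (r div 2) :: 'k poly poly poly) + g3 * v"
        by (simp add: algebra_simps)
      then have "emb3 (x2 ^ b * lift q m b r) = emb3 \<dots>" by (rule arg_cong)
      then show ?thesis
        by (intro exI[of _ "emb3 v"]) (simp only: emb3_hom)
    qed
    then obtain V where V: "\<And>r. emb3 x2 ^ b * emb3 (lift q m b r) = (- 1) ^ b * ?G1 ^ b * ?mono r + ?G3 * V r"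
      by metis
    \<comment> \<open>With the factor \<open>x2 ^ b\<close>, each lift is \<open>?G1 ^ b\<close>
      times a signed monomial modulo \<open>?G3\<close>, the shape required by
      \<open>symbolic_power_initial\<close>.\<close>
    have "emb3 x2 ^ b * (h + ?G3 * z) = (\<Sum>r<?N. W (a, b, r) * (emb3 x2 ^ b * emb3 (lift q m b r))) + ?G3 * (emb3 x2 ^ b * z)"
      by (simp only: h_def distrib_left sum_distrib_left mult.left_commute)
    also have "(\<Sum>r<?N. W (a, b, r) * (emb3 x2 ^ b * emb3 (lift q m b r))) =
        ?G1 ^ b * ((- 1) ^ b * y) + ?G3 * (\<Sum>r<?N. W (a, b, r) * V r)"
      unfolding V y_def by (simp only: distrib_left sum.distrib sum_distrib_left ac_simps)
    finally have "emb3 x2 ^ b * (h + ?G3 * z) =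
        ?G1 ^ b * ((- 1) ^ b * y) + ?G3 * ((\<Sum>r<?N. W (a, b, r) * V r) + emb3 x2 ^ b * z)"
      by (simp only: distrib_left add.assoc)
    moreover have "emb3 x2 ^ b * (h + ?G3 * z) \<in> symb (Suc b)"
      by (rule is_idealD(3)[OF is_ideal_symbolic_power[OF prime] hz])
    ultimately have initial: "?G1 ^ b * ((- 1) ^ b * y) +
        ?G3 * ((\<Sum>r<?N. W (a, b, r) * V r) + emb3 x2 ^ b * z) \<in> symb (Suc b)"
      by simp
    have "(- 1) ^ b * y \<in> curve_prime q m"
      by (rule symbolic_power_initial[OF regular initial])
    \<comment> \<open>The sign is its own inverse and is removed by multiplying once more.\<close>
    then have "(- 1) ^ b * ((- 1) ^ b * y) \<in> curve_prime q m"
      by (rule is_idealD(3)[OF prime_is_ideal[OF prime]])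
    then have "y \<in> curve_prime q m" by (simp flip: mult.assoc power_mult_distrib)
    then have "W (a, b, r) = 0"
      unfolding y_def
      by (rule residue_monomials_independent[OF coprime, rotated]) (use W i iab less.prems in auto)
    then show ?case by (simp add: b_def)
  qed
qed

text \<open>Division at level \<open>n\<close>: the terms of level \<open>n\<close> lie in the
  extension of \<open>cal_I\<close>, hence in the symbolic power. So the standard part lies there
  too, and its coefficients vanish.\<close>

lemma symbolic_power_subset_cal_I:
  fixes F :: "'k::field fps fps fps"
  assumes F: "F \<in> symb n"
  shows "F \<in> idl (emb3 ` cal_I q m n)"
proof -
  let ?I = "idl (emb3 ` cal_I q m n) :: 'k fps fps fps set"
  obtain W where W: "\<And>a b r k. a + b < n \<Longrightarrow> r < 2 * q + 1 \<Longrightarrow> W (a, b, r) $ k \<in> range (\<lambda>c. fps_const (fps_const c))"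
    "F = (\<Sum>u\<in>idx q n. W u * emb3 (elt q m u))"
    by (rule division_by_elt[OF qm, of n F]) (use that in blast)
  let ?gen = "{(a, b, r). a + b = n \<and> r < (2 :: nat)}"
  let ?std = "{(a, b, r). a + b < n \<and> r < 2 * q + 1}"
  have fin: "finite ?gen" "finite ?std"
    by (rule finite_subset[OF _ finite_idx[of q n]], auto simp: idx_def)+
  have split: "F = (\<Sum>u\<in>?std. W u * emb3 (elt q m u)) + (\<Sum>u\<in>?gen. W u * emb3 (elt q m u))"
    unfolding W(2) idx_def by (rule sum.union_disjoint[OF fin(2,1)]) auto
  have gen: "(\<Sum>u\<in>?gen. W u * emb3 (elt q m u)) \<in> ?I"
    using lift_in_cal_I[of _ q m]
    by (intro is_ideal_sum is_idealD(3) is_ideal_idl) (auto simp: elt_def intro!: idl_incl)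
  have "?I \<subseteq> symb n"
    using emb3_cal_I_subset[of n] weighted_sum_subset_symb[of n]
    by (intro idl_least is_ideal_symbolic_power prime) blast
  with gen have "(\<Sum>u\<in>?gen. W u * emb3 (elt q m u)) \<in> symb n" by blast
  from is_idealD(6)[OF is_ideal_symbolic_power[OF prime] F this]
  have std: "(\<Sum>u\<in>?std. W u * emb3 (elt q m u)) \<in> symb n"
    by (subst (asm) (1) split) simp
  have "W (a, b, r) = 0" if "a + b < n" "r < 2 * q + 1" for a b r
    using standard_coefficients_vanish[OF W(1) std, of "a + b" a r] that by simp
  then have "(\<Sum>u\<in>?std. W u * emb3 (elt q m u)) = 0" by (intro sum.neutral) auto
  with split gen show ?thesis by simp
qed

end

theorem theorem5p9:
  fixes q m n :: nat
  assumes "q \<ge> 1" and "m \<ge> 1" and "gcd (2 * q + 1) m = 1" and "n \<ge> 1"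
  shows "symbolic_power (curve_prime q m :: 'k::field fps fps fps set) n
           = idl (emb3 ` cal_I q m n)
       \<and> symbolic_power (curve_prime q m :: 'k fps fps fps set) n
           = weighted_sum (curve_prime q m) (symbolic_power (curve_prime q m) 2) n
       \<and> (initial_I q n :: 'k poly poly set) = poly_mod_x1 ` cal_I q m n
       \<and> fps_mod_x1 ` symbolic_power (curve_prime q m :: 'k fps fps fps set) n
           = idl (emb2 ` initial_I q n)"
proof -
  let ?P = "curve_prime q m :: 'k fps fps fps set"
  let ?J = "emb3 ` cal_I q m n :: 'k fps fps fps set"
  have coprime: "coprime (2 * q + 1) m" using assms(3) by (simp add: coprime_iff_gcd_eq_1)
  note ctx = assms(1,2) coprime
  note prime = curve_prime_primeideal[of q m, where 'k = 'k]
  have W: "is_ideal (weighted_sum ?P (symbolic_power ?P 2) n)"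
    by (intro is_ideal_weighted_sum prime_is_ideal is_ideal_symbolic_power prime)
  \<comment> \<open>Three inclusions in a cycle give both descriptions of the symbolic
    power.\<close>
  have sub: "symbolic_power ?P n \<subseteq> idl ?J" "idl ?J \<subseteq> weighted_sum ?P (symbolic_power ?P 2) n"
    "weighted_sum ?P (symbolic_power ?P 2) n \<subseteq> symbolic_power ?P n"
    using symbolic_power_subset_cal_I[OF ctx] idl_least[OF W emb3_cal_I_subset[OF ctx]]
      weighted_sum_subset_symb[OF ctx] by blast+
  then have P: "symbolic_power ?P n = idl ?J"
    "symbolic_power ?P n = weighted_sum ?P (symbolic_power ?P 2) n" by blast+

  have idl_uminus: "idl (insert (- a) S) = idl (insert a S)" for a :: "'k poly poly" and S
  proof -
    have "idl (insert (- a) S) \<subseteq> idl (insert a S)" for a :: "'k poly poly"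
      by (rule idl_least[OF is_ideal_idl]) (auto intro: idl_incl is_idealD(5)[OF is_ideal_idl])
    from this[of a] this[of "- a"] show ?thesis by simp
  qed
  have "poly_mod_x1 ` idl {g1 q m, g2 q m, g3} = idl {- (y3 ^ (q + 1)), - (y2 * y3 ^ q), (y2 ^ 2 :: 'k poly poly)}"
    by (simp only: poly_mod_x1.image_idl[OF poly_mod_x1_surj] image_insert image_empty
        poly_mod_x1_generators[OF assms(1,2)])
  also have "\<dots> = idl {y2 ^ 2, y2 * y3 ^ q, y3 ^ (q + 1)}"
  proof -
    \<comment> \<open>\<open>idl_uminus\<close> changes the sign of the element inserted first,
      hence the reordering.\<close>
    have "{- (y3 ^ (q + 1)), - (y2 * y3 ^ q), y2 ^ 2} = {- (y2 * y3 ^ q), - (y3 ^ (q + 1)), (y2 ^ 2 :: 'k poly poly)}"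
      "{y2 * y3 ^ q, - (y3 ^ (q + 1)), y2 ^ 2} = {- (y3 ^ (q + 1)), y2 * y3 ^ q, (y2 ^ 2 :: 'k poly poly)}"
      "{y3 ^ (q + 1), y2 * y3 ^ q, y2 ^ 2} = {y2 ^ 2, y2 * y3 ^ q, (y3 ^ (q + 1) :: 'k poly poly)}"
      by blast+
    then show ?thesis by (metis idl_uminus)
  qed
  finally have I: "poly_mod_x1 ` cal_I q m n = (initial_I q n :: 'k poly poly set)"
    by (simp only: cal_I_def initial_I_def poly_mod_x1.image_weighted_sum[OF poly_mod_x1_surj is_ideal_idl is_ideal_idl]
        poly_mod_x1.image_idl[OF poly_mod_x1_surj, of "{_}"] image_insert image_empty
        poly_mod_x1_generators[OF assms(1,2)] idl_uminus)
  \<comment> \<open>Reduction modulo \<open>x1\<close> commutes with the embeddings, so the image of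
    the extended ideal is the extension of the reduced one.\<close>
  have "fps_mod_x1 (emb3 p) = emb2 (poly_mod_x1 p)" for p :: "'k poly poly poly"
    by (simp add: fps_mod_x1_def poly_mod_x1_def)
  then have "fps_mod_x1 ` ?J = emb2 ` initial_I q n"
    by (simp add: image_image flip: I)
  then have "fps_mod_x1 ` symbolic_power ?P n = idl (emb2 ` initial_I q n)"
    by (simp only: P(1) fps_mod_x1.image_idl[OF fps_mod_x1_surj])
  with P I[symmetric] show ?thesis by (intro conjI)
qed

end
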